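(* There is a universal constant $C_1$ such that for every positive integer $s$ and every $x\in\mathbb{R}$, $$\big|P(X_s \leq \mu+x\sigma) - \Phi(x)\big| \leq \frac{C_1}{\sqrt{s}},$$ where $X_s$ is the size of an $(s,s+1)$-core with distinct parts chosen uniformly at random, $\mu$ is the mean and $\sigma$ the standard deviation of $X_s$, and $\Phi$ is the standard normal distribution function.
   Context: A partition $\lambda=(\lambda_1\ge\lambda_2\ge\dots\ge\lambda_k>0)$ of $n$ has size $n=\sum\lambda_i$. In its Ferrers diagram, the hook length of a cell is the number of cells strictly to its right in its row, plus the number of cells strictly above it in its column, plus one. A partition is an $s$-core if no cell has hook length $s$, and an $(s,t)$-core if it is both an $s$-core and a $t$-core. A partition has distinct parts if $\lambda_1>\lambda_2>\dots>\lambda_k$. For each positive integer $s$ there are finitely many $(s,s+1)$-cores with distinct parts, and $X_s$ is the size of one chosen uniformly among them. *)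

theory Defs
  imports "HOL-Probability.Probability"
begin

definition is_partition :: "nat list \<Rightarrow> bool" where
  "is_partition la \<longleftrightarrow> sorted_wrt (\<ge>) la \<and> (\<forall>p\<in>set la. p > 0)"

definition psize :: "nat list \<Rightarrow> nat" where
  "psize la = sum_list la"

definition distinct_parts :: "nat list \<Rightarrow> bool" where
  "distinct_parts la \<longleftrightarrow> sorted_wrt (>) la"

definition cells :: "nat list \<Rightarrow> (nat \<times> nat) set" where
  "cells la = {(i, j). i < length la \<and> j < la ! i}"

text \<open>Hook length: cells strictly right in the row, plus cells in the same column in
  later rows (strictly above in French notation), plus one.\<close>
definition hook :: "nat list \<Rightarrow> nat \<Rightarrow> nat \<Rightarrow> nat" where
  "hook la i j = (la ! i - j - 1) + card {r. i < r \<and> r < length la \<and> j < la ! r} + 1"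

definition is_core :: "nat \<Rightarrow> nat list \<Rightarrow> bool" where
  "is_core s la \<longleftrightarrow> (\<forall>(i, j)\<in>cells la. hook la i j \<noteq> s)"

definition dcores :: "nat \<Rightarrow> nat list set" where
  "dcores s = {la. is_partition la \<and> distinct_parts la \<and> is_core s la \<and> is_core (s + 1) la}"

definition Xdist :: "nat \<Rightarrow> nat list pmf" where
  "Xdist s = pmf_of_set (dcores s)"

definition core_mean :: "nat \<Rightarrow> real" where
  "core_mean s = measure_pmf.expectation (Xdist s) (\<lambda>la. real (psize la))"

definition core_sd :: "nat \<Rightarrow> real" where
  "core_sd s = sqrt (measure_pmf.variance (Xdist s) (\<lambda>la. real (psize la)))"

definition Phi :: "real \<Rightarrow> real" where
  "Phi x = measure (density lborel std_normal_density) {..x}"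

end

theory Submission
  imports Defs
begin

text \<open>
  A partition with distinct parts is an \<open>(s, s + 1)\<close>-core iff its perimeter is less than \<open>s\<close>. Hence, given
  the number \<open>k\<close> of parts, the set of parts \<open>S\<close> is a uniform \<open>k\<close>-subset of \<open>{1..n}\<close> with \<open>n = s - k\<close>. The
  normal approximation of \<open>X = \<Sum>S\<close> is obtained by Stein's method from two kinds of moves.
  Exchanging an element of \<open>S\<close> with a non-element has mean effect proportional to \<open>X - m\<close> with
  \<open>m = k(n + 1)/2\<close>, and \<open>2m\<close> is at the same time the death rate in a birth-death chain for \<open>k\<close>
  with birth rate \<open>(s - 2k)(s - 2k - 1) = s\<^sup>2 - s - 8m + 6k\<close>. Together they yield
  \<open>E[(X - \<mu>) f(X)] = E[T f] + 3/5 E[(k - E k) f(X)]\<close>, where \<open>T f\<close> is a weighted sum of increments of \<open>f\<close>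
  over steps of size at most \<open>s\<close>, of total weight \<open>O(s\<^sup>2)\<close>, while the standard deviation of \<open>X\<close> is of order \<open>s\<^sup>3\<^sup>/\<^sup>2\<close>.
  For the solution \<open>f\<close> of the Stein equation, \<open>T f\<close> is \<open>f'(X)\<close> times the quadratic form \<open>T id\<close>, which is concentrated
  to relative accuracy \<open>s\<^sup>-\<^sup>1\<^sup>/\<^sup>2\<close>; the jump of \<open>f'\<close> is absorbed by the bound
  \<open>P(\<bar>X - z\<bar> \<le> s) = O(s\<^sup>-\<^sup>1\<^sup>/\<^sup>2)\<close>, which the exchange moves give as well.
\<close>

section \<open>Cores as sets of parts\<close>

definition ksub :: "nat \<Rightarrow> nat \<Rightarrow> nat set set" where
  "ksub n k = {S. S \<subseteq> {1..n} \<and> card S = k}"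

text \<open>The sets of parts of \<open>(s, s + 1)\<close>-cores with distinct parts: such a core is characterised by its perimeter being less than \<open>s\<close>.\<close>

definition Om :: "nat \<Rightarrow> nat set set" where
  "Om s = {S. finite S \<and> S \<subseteq> {1..s - card S}}"

abbreviation gaps :: "nat \<Rightarrow> nat set \<Rightarrow> nat set" where
  "gaps s S \<equiv> {1..s - card S} - S"

definition X :: "nat set \<Rightarrow> real" where
  "X S = (\<Sum>i\<in>S. real i)"

text \<open>The amount by which \<open>X\<close> drops when the gap at \<open>x\<close> is closed
  and everything above it moves down by one.\<close>

definition num_above :: "nat \<Rightarrow> nat set \<Rightarrow> real" where
  "num_above x S = real (card {y \<in> S. x < y})"

lemma finite_ksub [simp]: "finite (ksub n k)"
  by (rule finite_subset[of _ "Pow {1..n}"]) (auto simp: ksub_def)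

lemma OmD:
  assumes "S \<in> Om s"
  shows "finite S" "S \<subseteq> {1..s - card S}" "2 * card S \<le> s"
    "real (s - card S) = real s - real (card S)"
    "real (card (gaps s S)) = real s - 2 * real (card S)"
proof -
  show fin: "finite S" and sub: "S \<subseteq> {1..s - card S}" using assms by (auto simp: Om_def)
  have le: "card S \<le> s - card S" using card_mono[OF _ sub] by simp
  then show two: "2 * card S \<le> s" by linarith
  show "real (s - card S) = real s - real (card S)" using two by (simp add: of_nat_diff)
  have "card (gaps s S) = s - card S - card S" using card_Diff_subset[OF fin sub] by simp
  then show "real (card (gaps s S)) = real s - 2 * real (card S)"
    using le two by (simp add: of_nat_diff)
qed

lemma finite_Om [simp]: "finite (Om s)"
proof (rule finite_subset)
  show "Om s \<subseteq> Pow {1..s}" by (fastforce simp: Om_def)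
qed simp

lemma empty_in_Om [simp]: "{} \<in> Om s"
  by (simp add: Om_def)

lemma card_Om_pos: "card (Om s) > 0"
  using finite_Om empty_in_Om card_gt_0_iff by blast

lemma sum_Om: "(\<Sum>S\<in>Om s. F S) = (\<Sum>k\<le>s. \<Sum>S\<in>ksub (s - k) k. F S)"
proof -
  have "Om s = (\<Union>k\<in>{..s}. ksub (s - k) k)"
  proof (intro equalityI subsetI)
    fix S assume "S \<in> Om s"
    with OmD[OF this] show "S \<in> (\<Union>k\<in>{..s}. ksub (s - k) k)"
      by (intro UN_I[of "card S"]) (auto simp: ksub_def)
  next
    fix S assume "S \<in> (\<Union>k\<in>{..s}. ksub (s - k) k)"
    then have "S \<subseteq> {1..s - card S}" by (auto simp: ksub_def)
    then show "S \<in> Om s" using finite_subset by (auto simp: Om_def)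
  qed
  also have "sum F \<dots> = (\<Sum>k\<le>s. \<Sum>S\<in>ksub (s - k) k. F S)"
    by (rule sum.UNION_disjoint) (auto simp: ksub_def)
  finally show ?thesis .
qed

section \<open>Exchange moves and their reversibility\<close>

lemma card_exchange:
  assumes "finite S" "i \<in> S" "j \<notin> S"
  shows "card (insert j (S - {i})) = card S"
  using assms card_Suc_Diff1[of S i] by simp

text \<open>An exchange preserves the cardinality, hence also the ambient interval, so sending (S,
  i, j) to (S - i + j, j, i) is an involution on the triples.\<close>

lemma sum_swap_pairs:
  fixes G :: "nat set \<Rightarrow> nat \<Rightarrow> nat \<Rightarrow> real"
  shows "(\<Sum>S\<in>Om s. \<Sum>i\<in>S. \<Sum>j\<in>gaps s S. G S i j) =
    (\<Sum>S\<in>Om s. \<Sum>i\<in>S. \<Sum>j\<in>gaps s S. G (insert j (S - {i})) j i)"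
proof -
  define Tr where "Tr = Sigma (Om s) (\<lambda>S. S \<times> gaps s S)"
  define sw :: "nat set \<times> nat \<times> nat \<Rightarrow> nat set \<times> nat \<times> nat"
    where "sw = (\<lambda>(S, i, j). (insert j (S - {i}), j, i))"
  have flat: "(\<Sum>S\<in>Om s. \<Sum>i\<in>S. \<Sum>j\<in>gaps s S. H S i j) = (\<Sum>(S, i, j)\<in>Tr. H S i j)"
    for H :: "nat set \<Rightarrow> nat \<Rightarrow> nat \<Rightarrow> real"
    unfolding Tr_def using OmD(1)
    by (subst sum.Sigma[symmetric]) (auto simp: sum.cartesian_product intro!: sum.cong)
  have sw: "sw p \<in> Tr" "sw (sw p) = p" if "p \<in> Tr" for p
  proof -
    obtain S i j where p: "p = (S, i, j)" by (metis prod_cases3)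
    have S: "S \<in> Om s" and ij: "i \<in> S" "j \<in> gaps s S" using that p by (auto simp: Tr_def)
    have c: "card (insert j (S - {i})) = card S"
      using OmD(1)[OF S] ij by (intro card_exchange) auto
    show "sw p \<in> Tr" using OmD(1,2)[OF S] ij unfolding p sw_def Tr_def Om_def
      by (auto simp: c)
    show "sw (sw p) = p" using ij by (auto simp: p sw_def)
  qed
  show ?thesis unfolding flat
    by (rule sum.reindex_bij_witness[of _ sw sw]) (use sw in \<open>auto simp: sw_def split: prod.splits\<close>)
qed

lemma X_exchange:
  assumes "finite S" "i \<in> S" "j \<notin> S"
  shows "X (insert j (S - {i})) = X S + (real j - real i)"
  using assms by (simp add: X_def sum_diff1)

lemma sum_exchange_differences:
  fixes g :: "nat \<Rightarrow> real"
  assumes "S \<in> Om s"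
  shows "(\<Sum>i\<in>S. \<Sum>j\<in>gaps s S. g j - g i) =
    real (card S) * (\<Sum>i=1..s - card S. g i) - real (s - card S) * (\<Sum>i\<in>S. g i)"
proof -
  note S = OmD[OF assms]
  have "(\<Sum>i\<in>S. \<Sum>j\<in>gaps s S. g j - g i) =
      card S * (\<Sum>j\<in>gaps s S. g j) - card (gaps s S) * (\<Sum>i\<in>S. g i)"
    by (simp add: sum_subtractf sum_distrib_left)
  also have "(\<Sum>j\<in>gaps s S. g j) = (\<Sum>i=1..s - card S. g i) - (\<Sum>i\<in>S. g i)"
    by (rule sum_diff) (use S in auto)
  finally show ?thesis unfolding S(4,5) by (simp add: algebra_simps)
qed

text \<open>Summation by parts for the reversible exchange chain: under the involution of
  \<open>sum_swap_pairs\<close> the factor \<open>g j - g i\<close> changes sign while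
  \<open>w (card S)\<close> is fixed, so both halves of the increment of \<open>F\<close> contribute
  equally, whence the factor 2.\<close>

lemma swap_identity:
  fixes g :: "nat \<Rightarrow> real" and F :: "nat set \<Rightarrow> real" and w :: "nat \<Rightarrow> real"
  shows "(\<Sum>S\<in>Om s. w (card S) * (\<Sum>i\<in>S. \<Sum>j\<in>gaps s S. (g j - g i) * (F (insert j (S - {i})) - F S))) =
    2 * (\<Sum>S\<in>Om s. w (card S) * (real (s - card S) * (\<Sum>i\<in>S. g i)
        - real (card S) * (\<Sum>i=1..s - card S. g i)) * F S)"
proof -
  let ?A = "\<Sum>S\<in>Om s. \<Sum>i\<in>S. \<Sum>j\<in>gaps s S. w (card S) * (g j - g i) * F S"
  let ?B = "\<Sum>S\<in>Om s. \<Sum>i\<in>S. \<Sum>j\<in>gaps s S. w (card S) * (g j - g i) * F (insert j (S - {i}))"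
  have "?A = (\<Sum>S\<in>Om s. \<Sum>i\<in>S. \<Sum>j\<in>gaps s S.
      w (card (insert j (S - {i}))) * (g i - g j) * F (insert j (S - {i})))"
    by (rule sum_swap_pairs)
  also have "\<dots> = (\<Sum>S\<in>Om s. \<Sum>i\<in>S. \<Sum>j\<in>gaps s S. - (w (card S) * (g j - g i) * F (insert j (S - {i}))))"
  proof (intro sum.cong refl)
    fix S i j assume "S \<in> Om s" "i \<in> S" "j \<in> gaps s S"
    then have "card (insert j (S - {i})) = card S" by (intro card_exchange) (auto simp: OmD(1))
    then show "w (card (insert j (S - {i}))) * (g i - g j) * F (insert j (S - {i})) =
        - (w (card S) * (g j - g i) * F (insert j (S - {i})))" by (simp only: minus_mult_left) (simp add: algebra_simps)
  qed
  finally have AB: "?A = - ?B" by (simp add: sum_negf)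
  have "(\<Sum>S\<in>Om s. w (card S) * (\<Sum>i\<in>S. \<Sum>j\<in>gaps s S. (g j - g i) * (F (insert j (S - {i})) - F S))) = ?B - ?A"
    unfolding sum_distrib_left sum_subtractf[symmetric] by (intro sum.cong refl) (simp add: algebra_simps)
  also have "\<dots> = - 2 * ?A" using AB by simp
  also have "?A = (\<Sum>S\<in>Om s. w (card S) * F S * (\<Sum>i\<in>S. \<Sum>j\<in>gaps s S. g j - g i))"
    by (simp add: sum_distrib_left mult_ac)
  also have "\<dots> = (\<Sum>S\<in>Om s. w (card S) * F S * (real (card S) * (\<Sum>i=1..s - card S. g i) - real (s - card S) * (\<Sum>i\<in>S. g i)))"
    by (intro sum.cong refl arg_cong2[where f = "(*)"] sum_exchange_differences)
  finally show ?thesis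
    unfolding sum_distrib_left[of "2" _ "Om s"] sum_distrib_left[of "-2" _ "Om s"]
    by (rule ssubst) (intro sum.cong refl, simp only: algebra_simps)
qed

section \<open>Birth and death moves\<close>

lemma sum_remove_element:
  fixes \<phi> :: "nat set \<Rightarrow> real"
  shows "(\<Sum>T\<in>ksub m (Suc k). \<Sum>t\<in>T. \<phi> (T - {t})) = (real m - real k) * (\<Sum>S\<in>ksub m k. \<phi> S)"
proof -
  have fin: "finite S" if "S \<in> ksub m k'" for S k'
    using that by (auto simp: ksub_def intro: finite_subset)
  have "(\<Sum>T\<in>ksub m (Suc k). \<Sum>t\<in>T. \<phi> (T - {t})) =
      (\<Sum>(T, t)\<in>Sigma (ksub m (Suc k)) (\<lambda>T. T). \<phi> (T - {t}))"
    by (rule sum.Sigma) (auto intro: fin)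
  \<comment> \<open>Double counting: a set with a marked element becomes a set with a marked outside
    point, of which there are m - k.\<close>
  also have "\<dots> = (\<Sum>(S, t)\<in>Sigma (ksub m k) (\<lambda>S. {1..m} - S). \<phi> S)"
    by (rule sum.reindex_bij_witness[of _ "\<lambda>(S, t). (insert t S, t)" "\<lambda>(T, t). (T - {t}, t)"])
      (auto simp: ksub_def card_insert_if finite_subset insert_absorb)
  also have "\<dots> = (\<Sum>S\<in>ksub m k. \<Sum>t\<in>{1..m} - S. \<phi> S)"
    by (rule sum.Sigma[symmetric]) auto
  also have "\<dots> = (\<Sum>S\<in>ksub m k. (real m - real k) * \<phi> S)"
  proof (intro sum.cong refl)
    fix S assume S: "S \<in> ksub m k"
    have "card ({1..m} - S) = m - k" "k \<le> m"
      using S fin[OF S] card_Diff_subset[of S "{1..m}"] card_mono[of "{1..m}" S] by (auto simp: ksub_def)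
    then show "(\<Sum>t\<in>{1..m} - S. \<phi> S) = (real m - real k) * \<phi> S" by (simp add: of_nat_diff)
  qed
  finally show ?thesis by (simp add: sum_distrib_left)
qed

text \<open>The order isomorphism from the numbers other than \<open>x\<close> onto the naturals; it
  relabels a set after the gap \<open>x\<close> is deleted. Its inverse is
  \<open>skip x\<close>.\<close>

definition squeeze :: "nat \<Rightarrow> nat \<Rightarrow> nat" where
  "squeeze x y = (if y < x then y else y - 1)"

definition skip :: "nat \<Rightarrow> nat \<Rightarrow> nat" where
  "skip x y = (if y < x then y else y + 1)"

lemma squeeze_skip: "squeeze x (skip x y) = y"
  by (simp add: squeeze_def skip_def)

lemma skip_squeeze: "y \<noteq> x \<Longrightarrow> skip x (squeeze x y) = y"
  by (auto simp: squeeze_def skip_def)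

lemma inj_on_squeeze: "x \<notin> S \<Longrightarrow> inj_on (squeeze x) S"
  by (rule inj_on_inverseI[of _ "skip x"]) (metis skip_squeeze)

lemma inj_on_skip: "inj_on (skip x) S"
  by (rule inj_on_inverseI[of _ "squeeze x"]) (auto simp: squeeze_skip)

lemma X_squeeze:
  assumes "finite S" "x \<notin> S"
  shows "X (squeeze x ` S) = X S - num_above x S"
proof -
  have "X (squeeze x ` S) = (\<Sum>y\<in>S. real (squeeze x y))"
    unfolding X_def by (simp add: sum.reindex inj_on_squeeze assms)
  also have "\<dots> = (\<Sum>y\<in>S. real y - (if x < y then 1 else 0))"
    using assms by (intro sum.cong refl) (auto simp: squeeze_def of_nat_diff)
  also have "\<dots> = X S - num_above x S"
    using assms by (simp add: X_def num_above_def sum_subtractf sum.If_cases Int_def)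
  finally show ?thesis .
qed

text \<open>Closing a gap leaves a k-subset of \<open>{1..m}\<close> together with a position;
  \<open>skip\<close> reopens a gap at any of the \<open>Suc m\<close> positions, so every k-subset
  arises exactly that often.\<close>

lemma sum_delete_gap:
  fixes \<phi> :: "nat set \<Rightarrow> real"
  shows "(\<Sum>S\<in>ksub (Suc m) k. \<Sum>x\<in>{1..Suc m} - S. \<phi> (squeeze x ` S)) = real (Suc m) * (\<Sum>S\<in>ksub m k. \<phi> S)"
proof -
  have "(\<Sum>S\<in>ksub (Suc m) k. \<Sum>x\<in>{1..Suc m} - S. \<phi> (squeeze x ` S)) =
      (\<Sum>(S, x)\<in>Sigma (ksub (Suc m) k) (\<lambda>S. {1..Suc m} - S). \<phi> (squeeze x ` S))"
    by (rule sum.Sigma) auto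
  also have "\<dots> = (\<Sum>(S, x)\<in>ksub m k \<times> {1..Suc m}. \<phi> S)"
  proof (rule sum.reindex_bij_witness[of _ "\<lambda>(S, x). (skip x ` S, x)" "\<lambda>(S, x). (squeeze x ` S, x)"], goal_cases)
    case (1 p)
    then obtain S x where p: "p = (S, x)" and x: "x \<notin> S" by auto
    have "skip x ` squeeze x ` S = (\<lambda>y. y) ` S"
      unfolding image_image by (intro image_cong refl skip_squeeze) (use x in blast)
    then show ?case by (simp add: p)
  next
    case (2 p)
    then obtain S x where p: "p = (S, x)" and S: "S \<subseteq> {1..Suc m}" "card S = k" "x \<notin> S" "1 \<le> x" "x \<le> Suc m"
      by (auto simp: ksub_def)
    have "squeeze x y \<in> {1..m}" if "y \<in> S" for y
    proof -
      have "y \<noteq> x" "1 \<le> y" "y \<le> Suc m" using that S by auto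
      then show ?thesis using S(4,5) by (auto simp: squeeze_def)
    qed
    then show ?case using S by (auto simp: p ksub_def card_image inj_on_squeeze)
  next
    case (3 p)
    then show ?case by (auto simp: image_image squeeze_skip)
  next
    case (4 p)
    then obtain S x where p: "p = (S, x)" and S: "S \<subseteq> {1..m}" "card S = k" "1 \<le> x" "x \<le> Suc m"
      by (auto simp: ksub_def)
    have "skip x y \<in> {1..Suc m}" "skip x y \<noteq> x" if "y \<in> S" for y
      using that S by (auto simp: skip_def)
    then show ?case using S by (force simp: p ksub_def card_image inj_on_skip)
  next
    case (5 p)
    then show ?case by auto
  qed
  also have "\<dots> = (\<Sum>S\<in>ksub m k. \<Sum>x\<in>{1..Suc m}. \<phi> S)"
    by (rule sum.cartesian_product[symmetric])
  finally show ?thesis by (simp add: sum_distrib_left)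
qed

lemma sum_pairs_below:
  fixes S :: "nat set"
  assumes "finite S"
  shows "(\<Sum>y\<in>S. real (card {z \<in> S. z < y})) = real (card S) * (real (card S) - 1) / 2"
  using assms
proof (induction S rule: finite_linorder_max_induct)
  case empty
  then show ?case by simp
next
  case (insert b A)
  have b: "b \<notin> A" using insert by auto
  have e: "{z \<in> insert b A. z < b} = A" using insert by auto
  have "(\<Sum>y\<in>A. real (card {z \<in> insert b A. z < y})) = (\<Sum>y\<in>A. real (card {z \<in> A. z < y}))"
  proof (intro sum.cong refl)
    fix y assume "y \<in> A"
    then have "{z \<in> insert b A. z < y} = {z \<in> A. z < y}" using insert by auto
    then show "real (card {z \<in> insert b A. z < y}) = real (card {z \<in> A. z < y})" by simp
  qed
  then show ?case using insert b e by (simp add: field_simps)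
qed

text \<open>Pairs of a gap below a part are counted from the part: below \<open>y\<close> there are
  y - 1 positive numbers, and those in \<open>S\<close>, which are not gaps, are totalled by
  \<open>sum_pairs_below\<close>.\<close>

lemma sum_above_gaps:
  assumes "finite S" "S \<subseteq> {1..n}"
  shows "(\<Sum>x\<in>{1..n} - S. num_above x S) = X S - real (card S) * (real (card S) + 1) / 2"
proof -
  have "(\<Sum>x\<in>{1..n} - S. num_above x S) = (\<Sum>x\<in>{1..n} - S. \<Sum>y\<in>S. if x < y then 1 else 0)"
    using assms by (simp add: num_above_def sum.If_cases Int_def)
  also have "\<dots> = (\<Sum>y\<in>S. \<Sum>x\<in>{1..n} - S. if x < y then 1 else 0)"
    by (rule sum.swap)
  also have "\<dots> = (\<Sum>y\<in>S. real y - 1 - real (card {z \<in> S. z < y}))"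
  proof (intro sum.cong refl)
    fix y assume y: "y \<in> S"
    have y1: "1 \<le> y" "y \<le> n" using y assms by auto
    have "{x \<in> {1..n} - S. x < y} = {1..<y} - {z \<in> S. z < y}" using assms y1 by auto
    moreover have "card ({1..<y} - {z \<in> S. z < y}) = card {1..<y} - card {z \<in> S. z < y}"
      by (rule card_Diff_subset) (use assms in auto)
    moreover have "card {z \<in> S. z < y} \<le> card {1..<y}"
      by (rule card_mono) (use assms in auto)
    ultimately have "real (card {x \<in> {1..n} - S. x < y}) = real y - 1 - real (card {z \<in> S. z < y})"
      using y1 by (simp add: of_nat_diff)
    then show "(\<Sum>x\<in>{1..n} - S. if x < y then 1 else 0) = real y - 1 - real (card {z \<in> S. z < y})"
      by (simp add: sum.If_cases Int_def)
  qed
  also have "\<dots> = X S - real (card S) - real (card S) * (real (card S) - 1) / 2"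
    using sum_pairs_below[OF assms(1)] by (simp add: sum_subtractf X_def)
  finally show ?thesis by (simp add: field_simps)
qed

text \<open>Removing a part from a \<open>(k + 1)\<close>-set and deleting a gap from a \<open>k\<close>-set both lead to uniform \<open>k\<close>-subsets of \<open>{1..s - k - 1}\<close>.\<close>

lemma birth_death_identity:
  fixes F :: "nat \<Rightarrow> real \<Rightarrow> real"
  assumes "s > 0"
  shows "(\<Sum>T\<in>Om s. (real s - real (card T) + 1) * (\<Sum>t\<in>T. F (card T) (X T - real t))) =
    (\<Sum>S\<in>Om s. (real s - 2 * real (card S) - 1) * (\<Sum>x\<in>gaps s S. F (Suc (card S)) (X S - num_above x S)))"
    (is "?L = ?R")
proof -
  let ?l = "\<lambda>k. \<Sum>T\<in>ksub (s - k) k. (real s - real k + 1) * (\<Sum>t\<in>T. F k (X T - real t))"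
  let ?r = "\<lambda>k. \<Sum>S\<in>ksub (s - k) k. (real s - 2 * real k - 1) * (\<Sum>x\<in>{1..s - k} - S. F (Suc k) (X S - num_above x S))"
  \<comment> \<open>With s - k = m + 1 the left prefactor is m + 1 and the right one m - k. Counting
    contributes m - k on the left and m + 1 on the right, so the products agree.\<close>
  have step: "?l (Suc k) = ?r k" if "k < s" for k
  proof -
    obtain m where m: "s - k = Suc m" using \<open>k < s\<close> by (metis Suc_diff_Suc)
    then have m': "s - Suc k = m" by simp
    have sm: "real s = real m + real k + 1" using m \<open>k < s\<close> by linarith
    have "(\<Sum>T\<in>ksub m (Suc k). \<Sum>t\<in>T. F (Suc k) (X T - real t)) =
        (\<Sum>T\<in>ksub m (Suc k). \<Sum>t\<in>T. F (Suc k) (X (T - {t})))"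
      by (intro sum.cong refl) (auto simp: X_def ksub_def sum_diff1 finite_subset)
    also have "\<dots> = (real m - real k) * (\<Sum>S\<in>ksub m k. F (Suc k) (X S))"
      by (rule sum_remove_element)
    finally have 1: "?l (Suc k) = real (Suc m) * (real m - real k) * (\<Sum>S\<in>ksub m k. F (Suc k) (X S))"
      using sm by (simp add: m' sum_distrib_left[symmetric])
    have "(\<Sum>S\<in>ksub (Suc m) k. \<Sum>x\<in>{1..Suc m} - S. F (Suc k) (X S - num_above x S)) =
        (\<Sum>S\<in>ksub (Suc m) k. \<Sum>x\<in>{1..Suc m} - S. F (Suc k) (X (squeeze x ` S)))"
      by (intro sum.cong refl) (auto simp: ksub_def X_squeeze finite_subset)
    also have "\<dots> = real (Suc m) * (\<Sum>S\<in>ksub m k. F (Suc k) (X S))"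
      by (rule sum_delete_gap)
    finally have "?r k = (real m - real k) * (real (Suc m) * (\<Sum>S\<in>ksub m k. F (Suc k) (X S)))"
      unfolding m sum_distrib_left[symmetric] using sm by simp
    with 1 show ?thesis by simp
  qed
  \<comment> \<open>The boundary terms vanish: the empty set has no part to remove, and for k = s
    the interval \<open>{1..0}\<close> has no gap. Hence the index shift loses nothing.\<close>
  have l0: "?l 0 = 0"
    by (intro sum.neutral) (auto simp: ksub_def finite_subset)
  have rs: "?r s = 0"
    by simp
  have "?L = sum ?l {..s}"
    unfolding sum_Om by (intro sum.cong refl) (simp add: ksub_def)
  also have "\<dots> = ?l 0 + (\<Sum>k<s. ?l (Suc k))"
    by (rule sum.atMost_shift)
  also have "\<dots> = 0 + (\<Sum>k<s. ?r k)"
    by (rule arg_cong2[where f = "(+)", OF l0 sum.cong[OF refl step]]) (simp only: lessThan_iff)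
  also have "\<dots> = sum ?r {..<Suc s}"
    by (simp only: sum.lessThan_Suc rs)
  also have "\<dots> = sum ?r {..s}"
    by (simp only: lessThan_Suc_atMost)
  also have "\<dots> = ?R"
    unfolding sum_Om by (intro sum.cong refl) (simp add: ksub_def)
  finally show ?thesis .
qed

section \<open>The Stein equation\<close>

lemma Phi_eq_cdf: "Phi = cdf std_normal_distribution"
  by (rule ext) (simp add: Phi_def cdf_def2)

lemma Phi_nonneg: "0 \<le> Phi x"
  by (simp add: Phi_def)

lemma Phi_le_1: "Phi x \<le> 1"
proof -
  interpret real_distribution std_normal_distribution by (rule real_dist_normal_dist)
  show ?thesis unfolding Phi_eq_cdf by (rule cdf_bounded_prob)
qed

lemma Phi_mono: "x \<le> y \<Longrightarrow> Phi x \<le> Phi y"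
proof -
  interpret real_distribution std_normal_distribution by (rule real_dist_normal_dist)
  show "x \<le> y \<Longrightarrow> Phi x \<le> Phi y" unfolding Phi_eq_cdf by (rule cdf_nondecreasing)
qed

lemma Phi_at_top: "(Phi \<longlongrightarrow> 1) at_top" and Phi_at_bot: "(Phi \<longlongrightarrow> 0) at_bot"
proof -
  interpret real_distribution std_normal_distribution by (rule real_dist_normal_dist)
  show "(Phi \<longlongrightarrow> 1) at_top" unfolding Phi_eq_cdf by (rule cdf_lim_at_top_prob)
  show "(Phi \<longlongrightarrow> 0) at_bot" unfolding Phi_eq_cdf by (rule cdf_lim_at_bot)
qed

lemma continuous_std_normal_density: "continuous_on A std_normal_density"
  unfolding std_normal_density_def by (intro continuous_intros) auto

lemma Phi_diff:
  assumes "a \<le> x"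
  shows "Phi x - Phi a = integral {a..x} std_normal_density"
proof (cases "a = x")
  case True
  then show ?thesis by simp
next
  case False
  interpret real_distribution std_normal_distribution by (rule real_dist_normal_dist)
  have int: "set_integrable lborel {a<..x} std_normal_density"
    unfolding set_integrable_def by (intro integrable_mult_indicator) auto
  have "Phi x - Phi a = measure std_normal_distribution {a<..x}"
    unfolding Phi_eq_cdf by (rule cdf_diff_eq) (use assms False in simp)
  also have "\<dots> = (LINT y|std_normal_distribution. indicator {a<..x} y)"
    by simp
  also have "\<dots> = (LINT y:{a<..x}|lborel. std_normal_density y)"
    unfolding set_lebesgue_integral_def by (subst integral_density) (auto simp: mult.commute)
  also have "\<dots> = integral {a<..x} std_normal_density"
    by (rule set_borel_integral_eq_integral[OF int])
  also have "\<dots> = integral {a..x} std_normal_density"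
  proof (rule integral_spike_set)
    show "negligible {y \<in> {a<..x} - {a..x}. std_normal_density y \<noteq> 0}"
      by (rule negligible_subset[of "{a}"]) auto
    show "negligible {y \<in> {a..x} - {a<..x}. std_normal_density y \<noteq> 0}"
      by (rule negligible_subset[of "{a}"]) auto
  qed
  finally show ?thesis .
qed

lemma Phi_has_derivative [derivative_intros]:
  "(Phi has_real_derivative std_normal_density x) (at x)"
proof -
  have "((\<lambda>y. integral {x - 1..y} std_normal_density) has_real_derivative std_normal_density x)
      (at x within {x - 1..x + 1})"
    by (rule integral_has_real_derivative) (auto simp: continuous_std_normal_density)
  then have "((\<lambda>y. Phi (x - 1) + integral {x - 1..y} std_normal_density) has_real_derivative std_normal_density x)
      (at x within {x - 1..x + 1})"
    by (auto intro!: derivative_eq_intros)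
  then have "(Phi has_real_derivative std_normal_density x) (at x within {x - 1..x + 1})"
    by (rule has_field_derivative_transform_within[of _ _ _ _ 1]) (auto simp: Phi_diff[symmetric])
  moreover have "at x within {x - 1..x + 1} = at x"
    by (rule at_within_interior) simp
  ultimately show ?thesis by simp
qed

lemma std_normal_density_pos: "0 < std_normal_density x"
  by (rule normal_density_pos) simp

lemma std_normal_density_has_derivative:
  "(std_normal_density has_real_derivative - x * std_normal_density x) (at x)"
  unfolding std_normal_density_def by (auto intro!: derivative_eq_intros simp: field_simps)

lemma std_normal_density_le_1: "std_normal_density x \<le> 1"
proof -
  have "1 \<le> sqrt (2 * pi)" using pi_gt3 by simp
  moreover have "exp (- x\<^sup>2 / 2) \<le> 1" by simp
  ultimately show ?thesis unfolding std_normal_density_def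
    using order_trans[of "exp (- x\<^sup>2 / 2)" 1 "sqrt (2 * pi)"] by (simp add: divide_le_eq)
qed

lemma std_normal_density_div_at_top: "((\<lambda>x. std_normal_density x / x) \<longlongrightarrow> 0) at_top"
proof (rule Lim_null_comparison)
  show "\<forall>\<^sub>F x in at_top. norm (std_normal_density x / x) \<le> 1 / x"
    using eventually_gt_at_top[of 0]
    by eventually_elim (simp add: divide_right_mono std_normal_density_le_1)
  show "((\<lambda>x. 1 / x) \<longlongrightarrow> (0::real)) at_top"
    by (rule tendsto_divide_0[OF tendsto_const]) (rule filterlim_at_top_imp_at_infinity, rule filterlim_ident)
qed

lemma std_normal_density_div_at_bot: "((\<lambda>x. std_normal_density x / x) \<longlongrightarrow> 0) at_bot"
proof -
  have "((\<lambda>x. - (std_normal_density x / x)) \<longlongrightarrow> -0) at_top"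
    by (intro tendsto_minus std_normal_density_div_at_top)
  then show ?thesis
    unfolding filterlim_at_bot_mirror by (simp add: std_normal_density_def)
qed

text \<open>On the positive half-line \<open>?h\<close> has derivative minus the density over the
  square of x, and it tends to 0 at infinity; a decreasing function with limit 0 is
  positive.\<close>

lemma Mills_upper:
  assumes "w > 0"
  shows "w * (1 - Phi w) \<le> std_normal_density w"
proof -
  let ?h = "\<lambda>x. std_normal_density x / x - (1 - Phi x)"
  have "0 < ?h w"
  proof (rule DERIV_neg_imp_decreasing_at_top[where f = ?h])
    fix x assume "w \<le> x"
    then have x: "x > 0" using assms by simp
    have "(?h has_real_derivative - std_normal_density x / x\<^sup>2) (at x)"
      using x by (auto intro!: derivative_eq_intros std_normal_density_has_derivative
          simp: field_simps power2_eq_square)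
    moreover have "- std_normal_density x / x\<^sup>2 < 0" using x std_normal_density_pos[of x] by simp
    ultimately show "\<exists>y. (?h has_real_derivative y) (at x) \<and> y < 0" by blast
  next
    have "(?h \<longlongrightarrow> 0 - (1 - 1)) at_top"
      by (intro tendsto_diff tendsto_const std_normal_density_div_at_top Phi_at_top)
    then show "(?h \<longlongrightarrow> 0) at_top" by simp
  qed
  then show ?thesis using assms by (simp add: field_simps)
qed

lemma Mills_lower:
  assumes "w < 0"
  shows "- w * Phi w \<le> std_normal_density w"
proof -
  let ?h = "\<lambda>x. - (std_normal_density x / x) - Phi x"
  have "0 < ?h w"
  proof (rule DERIV_pos_imp_increasing_at_bot[where f = ?h])
    fix x assume "x \<le> w"
    then have x: "x < 0" using assms by simp
    have "(?h has_real_derivative std_normal_density x / x\<^sup>2) (at x)"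
      using x by (auto intro!: derivative_eq_intros std_normal_density_has_derivative
          simp: field_simps power2_eq_square)
    moreover have "std_normal_density x / x\<^sup>2 > 0" using x std_normal_density_pos[of x] by simp
    ultimately show "\<exists>y. (?h has_real_derivative y) (at x) \<and> y > 0" by blast
  next
    have "(?h \<longlongrightarrow> - 0 - 0) at_bot"
      by (intro tendsto_diff tendsto_minus std_normal_density_div_at_bot Phi_at_bot)
    then show "(?h \<longlongrightarrow> 0) at_bot" by simp
  qed
  then show ?thesis using assms by (simp add: field_simps)
qed

section \<open>The bounded solution of the Stein equation\<close>

definition stein_num :: "real \<Rightarrow> real \<Rightarrow> real" where
  "stein_num z w = (if w \<le> z then Phi w * (1 - Phi z) else Phi z * (1 - Phi w))"

text \<open>The classical solution of f'(w) - w f(w) = 1[w \<le> z] - Phi(z). Its numerator is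
  Phi(min w z) (1 - Phi(max w z)), the choice that keeps f bounded at both ends.\<close>

definition stein_sol :: "real \<Rightarrow> real \<Rightarrow> real" where
  "stein_sol z w = stein_num z w / std_normal_density w"

text \<open>The derivative of the Stein solution away from \<open>z\<close>; at \<open>z\<close>, where it jumps, the left limit.\<close>

definition stein_deriv :: "real \<Rightarrow> real \<Rightarrow> real" where
  "stein_deriv z w = w * stein_sol z w + (if w \<le> z then 1 else 0) - Phi z"

lemma stein_num_bounds:
  "0 \<le> stein_num z w" "stein_num z w \<le> Phi w" "stein_num z w \<le> 1 - Phi w"
proof -
  note P = Phi_nonneg[of w] Phi_le_1[of w] Phi_nonneg[of z] Phi_le_1[of z]
  show "0 \<le> stein_num z w" using P by (simp add: stein_num_def)
  show "stein_num z w \<le> Phi w"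
  proof (cases "w \<le> z")
    case True
    then show ?thesis using P by (simp add: stein_num_def mult_left_le)
  next
    case False
    then have "Phi z * (1 - Phi w) \<le> Phi w * 1"
      using P Phi_mono[of z w] by (intro mult_mono) auto
    then show ?thesis using False by (simp add: stein_num_def)
  qed
  show "stein_num z w \<le> 1 - Phi w"
  proof (cases "w \<le> z")
    case True
    then have "Phi w * (1 - Phi z) \<le> 1 * (1 - Phi w)"
      using P Phi_mono[of w z] by (intro mult_mono) auto
    then show ?thesis using True by (simp add: stein_num_def)
  next
    case False
    then show ?thesis using P by (simp add: stein_num_def mult_left_le_one_le)
  qed
qed

text \<open>The numerator lies below both tails \<open>Phi w\<close> and \<open>1 - Phi w\<close>;
  the tail on the side of the sign of \<open>w\<close> is controlled by the Mills bounds.\<close>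

lemma abs_mult_stein_sol_le: "\<bar>w * stein_sol z w\<bar> \<le> 1"
proof -
  note N = stein_num_bounds[of z w]
  have pos: "std_normal_density w > 0" by (rule std_normal_density_pos)
  have "\<bar>w\<bar> * stein_num z w \<le> std_normal_density w"
  proof (cases w "0::real" rule: linorder_cases)
    case less
    then have "- w * stein_num z w \<le> - w * Phi w" using N by (intro mult_left_mono) auto
    also have "\<dots> \<le> std_normal_density w" by (rule Mills_lower[OF less])
    finally show ?thesis using less by simp
  next
    case greater
    then have "w * stein_num z w \<le> w * (1 - Phi w)" using N by (intro mult_left_mono) auto
    also have "\<dots> \<le> std_normal_density w" by (rule Mills_upper[OF greater])
    finally show ?thesis using greater by simp
  qed simp
  then show ?thesis using pos N
    by (simp add: stein_sol_def abs_mult del: normal_density_pos)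
qed

text \<open>Outside (-1, 1) the bound on w f(w) is enough. Inside, 9 = 3 * 3 bounds the reciprocal
  density, from sqrt(2 pi) \<le> 3 and exp(1/2) \<le> exp 1 \<le> 3.\<close>

lemma abs_stein_sol_le: "\<bar>stein_sol z w\<bar> \<le> 9"
proof (cases "\<bar>w\<bar> \<ge> 1")
  case True
  have "1 * \<bar>stein_sol z w\<bar> \<le> \<bar>w\<bar> * \<bar>stein_sol z w\<bar>" using True by (intro mult_right_mono) auto
  then show ?thesis using abs_mult_stein_sol_le[of w z] by (simp add: abs_mult)
next
  case False
  note N = stein_num_bounds[of z w]
  have s3: "sqrt (2 * pi) \<le> 3"
    using pi_less_4 by (intro real_le_lsqrt) auto
  have "w\<^sup>2 \<le> 1" using False by (simp add: abs_square_le_1)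
  then have "exp (w\<^sup>2 / 2) \<le> exp 1" by simp
  then have e3: "exp (w\<^sup>2 / 2) \<le> 3" using exp_le by linarith
  have "\<bar>stein_sol z w\<bar> = stein_num z w * (sqrt (2 * pi) * exp (w\<^sup>2 / 2))"
    using N by (simp add: stein_sol_def std_normal_density_def exp_minus field_simps)
  also have "\<dots> \<le> 1 * (3 * 3)"
    using N Phi_le_1[of w] s3 e3 by (intro mult_mono) auto
  finally show ?thesis by simp
qed

lemma abs_stein_deriv_le: "\<bar>stein_deriv z w\<bar> \<le> 2"
proof -
  have "\<bar>(if w \<le> z then 1 else 0) - Phi z\<bar> \<le> 1"
    using Phi_nonneg[of z] Phi_le_1[of z] by auto
  then show ?thesis using abs_mult_stein_sol_le[of w z] unfolding stein_deriv_def by linarith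
qed

lemma stein_equation: "stein_deriv z w - w * stein_sol z w = (if w \<le> z then 1 else 0) - Phi z"
  by (simp add: stein_deriv_def)

text \<open>Left of \<open>z\<close> the solution coincides with a function \<open>h\<close> that is
  differentiable on the whole line, so the mean value theorem reaches up to the kink at
  \<open>z\<close> itself.\<close>

lemma stein_mvt_le:
  assumes "a < b" "b \<le> z"
  obtains \<xi> where "a < \<xi>" "\<xi> < b" "stein_sol z b - stein_sol z a = (b - a) * (\<xi> * stein_sol z \<xi> + 1 - Phi z)"
proof -
  define h where "h = (\<lambda>w. Phi w * (1 - Phi z) / std_normal_density w)"
  have "\<exists>\<xi>. a < \<xi> \<and> \<xi> < b \<and> h b - h a = (b - a) * (\<xi> * h \<xi> + (1 - Phi z))"
  proof (rule MVT2)
    fix x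
    have "std_normal_density x \<noteq> 0" using std_normal_density_pos[of x] by simp
    then show "(h has_real_derivative x * h x + (1 - Phi z)) (at x)"
      unfolding h_def by (auto intro!: derivative_eq_intros std_normal_density_has_derivative
          simp: field_simps power2_eq_square)
  qed (rule assms)
  then obtain \<xi> where \<xi>: "a < \<xi>" "\<xi> < b" "h b - h a = (b - a) * (\<xi> * h \<xi> + (1 - Phi z))" by blast
  moreover have "h w = stein_sol z w" if "w \<le> z" for w
    using that by (simp add: h_def stein_sol_def stein_num_def)
  ultimately show ?thesis using assms by (intro that[of \<xi>]) (auto simp: algebra_simps)
qed

lemma stein_mvt_ge:
  assumes "a < b" "z \<le> a"
  obtains \<xi> where "a < \<xi>" "\<xi> < b" "stein_sol z b - stein_sol z a = (b - a) * (\<xi> * stein_sol z \<xi> - Phi z)"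
proof -
  define h where "h = (\<lambda>w. Phi z * (1 - Phi w) / std_normal_density w)"
  have "\<exists>\<xi>. a < \<xi> \<and> \<xi> < b \<and> h b - h a = (b - a) * (\<xi> * h \<xi> - Phi z)"
  proof (rule MVT2)
    fix x
    have "std_normal_density x \<noteq> 0" using std_normal_density_pos[of x] by simp
    then show "(h has_real_derivative x * h x - Phi z) (at x)"
      unfolding h_def by (auto intro!: derivative_eq_intros std_normal_density_has_derivative
          simp: field_simps power2_eq_square)
  qed (rule assms)
  then obtain \<xi> where \<xi>: "a < \<xi>" "\<xi> < b" "h b - h a = (b - a) * (\<xi> * h \<xi> - Phi z)" by blast
  moreover have "h w = stein_sol z w" if "z \<le> w" for w
    using that by (cases "w = z") (auto simp: h_def stein_sol_def stein_num_def)
  ultimately show ?thesis using assms by (intro that[of \<xi>]) auto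
qed

lemma stein_sol_lipschitz: "\<bar>stein_sol z b - stein_sol z a\<bar> \<le> 2 * \<bar>b - a\<bar>"
proof -
  have le: "\<bar>stein_sol z b - stein_sol z a\<bar> \<le> 2 * (b - a)" if "a \<le> b" "b \<le> z" for a b
  proof (cases "a = b")
    case False
    with that obtain \<xi> where \<xi>: "stein_sol z b - stein_sol z a = (b - a) * (\<xi> * stein_sol z \<xi> + 1 - Phi z)"
      using stein_mvt_le[of a b z] by (metis order_le_less)
    have "\<bar>\<xi> * stein_sol z \<xi> + 1 - Phi z\<bar> \<le> 2"
      using abs_mult_stein_sol_le[of \<xi> z] Phi_nonneg[of z] Phi_le_1[of z] by linarith
    then have "(b - a) * \<bar>\<xi> * stein_sol z \<xi> + 1 - Phi z\<bar> \<le> (b - a) * 2"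
      using that by (intro mult_left_mono) auto
    then show ?thesis using that by (simp add: \<xi> abs_mult)
  qed simp
  have ge: "\<bar>stein_sol z b - stein_sol z a\<bar> \<le> 2 * (b - a)" if "a \<le> b" "z \<le> a" for a b
  proof (cases "a = b")
    case False
    with that obtain \<xi> where \<xi>: "stein_sol z b - stein_sol z a = (b - a) * (\<xi> * stein_sol z \<xi> - Phi z)"
      using stein_mvt_ge[of a b z] by (metis order_le_less)
    have "\<bar>\<xi> * stein_sol z \<xi> - Phi z\<bar> \<le> 2"
      using abs_mult_stein_sol_le[of \<xi> z] Phi_nonneg[of z] Phi_le_1[of z] by linarith
    then have "(b - a) * \<bar>\<xi> * stein_sol z \<xi> - Phi z\<bar> \<le> (b - a) * 2"
      using that by (intro mult_left_mono) auto
    then show ?thesis using that by (simp add: \<xi> abs_mult)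
  qed simp
  \<comment> \<open>An interval with the kink in its interior is cut at \<open>z\<close>.\<close>
  have all: "\<bar>stein_sol z b - stein_sol z a\<bar> \<le> 2 * (b - a)" if "a \<le> b" for a b
  proof (cases "b \<le> z \<or> z \<le> a")
    case True
    then show ?thesis using le ge that by blast
  next
    case False
    then have "\<bar>stein_sol z z - stein_sol z a\<bar> \<le> 2 * (z - a)" "\<bar>stein_sol z b - stein_sol z z\<bar> \<le> 2 * (b - z)"
      using le[of a z] ge[of z b] by auto
    then show ?thesis by (smt (verit))
  qed
  show ?thesis using all[of a b] all[of b a] by (cases "a \<le> b") auto
qed

text \<open>If \<open>z\<close> is farther than \<bar>u\<bar> from \<open>a\<close>, the segment
  stays on one side of the kink and the remainder is governed by the variation of w f(w), where 9
  bounds f and 2 its slope. Otherwise the jump of the derivative leaves a first-order bound: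
  2\<bar>u\<bar> for the increment and 2\<bar>u\<bar> for the linear term.\<close>

lemma stein_sol_taylor:
  "\<bar>stein_sol z (a + u) - stein_sol z a - u * stein_deriv z a\<bar>
    \<le> u\<^sup>2 * (9 + 2 * \<bar>a\<bar>) + (if \<bar>a - z\<bar> \<le> \<bar>u\<bar> then 4 * \<bar>u\<bar> else 0)"
proof -
  let ?D = "stein_sol z (a + u) - stein_sol z a"
  have near: "\<bar>\<xi> * stein_sol z \<xi> - a * stein_sol z a\<bar> \<le> \<bar>u\<bar> * (9 + 2 * \<bar>a\<bar>)" if "\<bar>\<xi> - a\<bar> \<le> \<bar>u\<bar>" for \<xi>
  proof -
    have "\<xi> * stein_sol z \<xi> - a * stein_sol z a = (\<xi> - a) * stein_sol z \<xi> + a * (stein_sol z \<xi> - stein_sol z a)"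
      by (simp add: algebra_simps)
    also have "\<bar>\<dots>\<bar> \<le> \<bar>\<xi> - a\<bar> * \<bar>stein_sol z \<xi>\<bar> + \<bar>a\<bar> * \<bar>stein_sol z \<xi> - stein_sol z a\<bar>"
      by (metis abs_mult abs_triangle_ineq)
    also have "\<dots> \<le> \<bar>u\<bar> * 9 + \<bar>a\<bar> * (2 * \<bar>u\<bar>)"
    proof (intro add_mono mult_mono order_refl)
      show "\<bar>stein_sol z \<xi> - stein_sol z a\<bar> \<le> 2 * \<bar>u\<bar>"
        by (rule order_trans[OF stein_sol_lipschitz]) (use that in simp)
    qed (use that abs_stein_sol_le in auto)
    finally show ?thesis by (simp add: algebra_simps)
  qed
  have same: ?thesis if "?D = u * (\<xi> * stein_sol z \<xi> + c)" "stein_deriv z a = a * stein_sol z a + c" "\<bar>\<xi> - a\<bar> \<le> \<bar>u\<bar>" for \<xi> c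
  proof -
    have "?D - u * stein_deriv z a = u * (\<xi> * stein_sol z \<xi> - a * stein_sol z a)"
      unfolding that by (simp add: algebra_simps)
    then have "\<bar>?D - u * stein_deriv z a\<bar> \<le> \<bar>u\<bar> * (\<bar>u\<bar> * (9 + 2 * \<bar>a\<bar>))"
      using mult_left_mono[OF near[OF that(3)], of "\<bar>u\<bar>"] by (simp add: abs_mult)
    also have "\<dots> = u\<^sup>2 * (9 + 2 * \<bar>a\<bar>)" by (simp add: power2_eq_square)
    finally show ?thesis by (smt (verit) abs_ge_zero)
  qed
  consider "u = 0" | "u \<noteq> 0" "\<bar>a - z\<bar> \<le> \<bar>u\<bar>" | "u \<noteq> 0" "a \<le> z" "a + u \<le> z" | "u \<noteq> 0" "z < a" "z < a + u"
    by linarith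
  then show ?thesis
  proof cases
    case 1
    then show ?thesis by simp
  next
    case 2
    have "\<bar>u * stein_deriv z a\<bar> \<le> \<bar>u\<bar> * 2"
      unfolding abs_mult using abs_stein_deriv_le[of z a] by (intro mult_left_mono) auto
    moreover have "0 \<le> u\<^sup>2 * (9 + 2 * \<bar>a\<bar>)" by simp
    ultimately show ?thesis using 2 stein_sol_lipschitz[of z "a + u" a] by (smt (verit))
  next
    case 3
    have "\<exists>\<xi>. ?D = u * (\<xi> * stein_sol z \<xi> + (1 - Phi z)) \<and> \<bar>\<xi> - a\<bar> \<le> \<bar>u\<bar>"
    proof (cases "u > 0")
      case True
      then obtain \<xi> where "a < \<xi>" "\<xi> < a + u" "?D = (a + u - a) * (\<xi> * stein_sol z \<xi> + 1 - Phi z)"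
        using stein_mvt_le[of a "a + u" z] 3 by auto
      then show ?thesis by (intro exI[of _ \<xi>]) (auto simp: algebra_simps)
    next
      case False
      then obtain \<xi> where "a + u < \<xi>" "\<xi> < a" "- ?D = (a - (a + u)) * (\<xi> * stein_sol z \<xi> + 1 - Phi z)"
        using stein_mvt_le[of "a + u" a z] 3 by auto
      then show ?thesis by (intro exI[of _ \<xi>]) (auto simp: algebra_simps)
    qed
    then show ?thesis using 3 same[where c = "1 - Phi z"] by (auto simp: stein_deriv_def)
  next
    case 4
    have "\<exists>\<xi>. ?D = u * (\<xi> * stein_sol z \<xi> + (- Phi z)) \<and> \<bar>\<xi> - a\<bar> \<le> \<bar>u\<bar>"
    proof (cases "u > 0")
      case True
      then obtain \<xi> where "a < \<xi>" "\<xi> < a + u" "?D = (a + u - a) * (\<xi> * stein_sol z \<xi> - Phi z)"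
        using stein_mvt_ge[of a "a + u" z] 4 by auto
      then show ?thesis by (intro exI[of _ \<xi>]) (auto simp: algebra_simps)
    next
      case False
      then obtain \<xi> where "a + u < \<xi>" "\<xi> < a" "- ?D = (a - (a + u)) * (\<xi> * stein_sol z \<xi> - Phi z)"
        using stein_mvt_ge[of "a + u" a z] 4 by auto
      then show ?thesis by (intro exI[of _ \<xi>]) (auto simp: algebra_simps)
    qed
    then show ?thesis using 4 same[where c = "- Phi z"] by (auto simp: stein_deriv_def)
  qed
qed

section \<open>Averages and the Stein identity\<close>

definition av :: "nat \<Rightarrow> (nat set \<Rightarrow> real) \<Rightarrow> real" where
  "av s F = (\<Sum>S\<in>Om s. F S) / real (card (Om s))"

lemma av_add: "av s (\<lambda>S. F S + G S) = av s F + av s G"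
  by (simp add: av_def sum.distrib add_divide_distrib)

lemma av_diff: "av s (\<lambda>S. F S - G S) = av s F - av s G"
  by (simp add: av_def sum_subtractf diff_divide_distrib)

lemma av_cmult: "av s (\<lambda>S. c * F S) = c * av s F"
  by (simp add: av_def sum_distrib_left)

lemma av_const [simp]: "av s (\<lambda>_. c) = c"
  using card_Om_pos[of s] by (auto simp: av_def)

lemma av_cong: "(\<And>S. S \<in> Om s \<Longrightarrow> F S = G S) \<Longrightarrow> av s F = av s G"
  unfolding av_def by (metis sum.cong)

lemma av_mono: "(\<And>S. S \<in> Om s \<Longrightarrow> F S \<le> G S) \<Longrightarrow> av s F \<le> av s G"
  unfolding av_def by (intro divide_right_mono sum_mono) auto

lemma abs_av_le: "\<bar>av s F\<bar> \<le> av s (\<lambda>S. \<bar>F S\<bar>)"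
  unfolding av_def by (simp add: abs_divide divide_right_mono sum_abs)

lemma av_abs_le_sqrt: "av s (\<lambda>S. \<bar>F S\<bar>) \<le> sqrt (av s (\<lambda>S. (F S)\<^sup>2))"
proof (rule real_le_rsqrt)
  let ?a = "av s (\<lambda>S. \<bar>F S\<bar>)"
  have "0 = av s (\<lambda>S. 0)" by simp
  also have "\<dots> \<le> av s (\<lambda>S. (\<bar>F S\<bar> - ?a)\<^sup>2)" by (rule av_mono) simp
  also have "\<dots> = av s (\<lambda>S. ((F S)\<^sup>2 - (2 * ?a) * \<bar>F S\<bar>) + ?a\<^sup>2)"
    by (rule av_cong) (simp add: power2_diff)
  also have "\<dots> = av s (\<lambda>S. (F S)\<^sup>2) - ?a\<^sup>2"
    unfolding av_add av_diff av_cmult by (simp add: power2_eq_square)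
  finally show "?a\<^sup>2 \<le> av s (\<lambda>S. (F S)\<^sup>2)" by simp
qed

lemma av_sq_boundD:
  assumes "av s (\<lambda>S. (F S)\<^sup>2) \<le> c\<^sup>2" "0 \<le> c"
  shows "av s (\<lambda>S. \<bar>F S\<bar>) \<le> c"
  using order_trans[OF av_abs_le_sqrt real_le_lsqrt[OF assms(2,1)]] by simp

section \<open>The forms attached to the two kinds of moves\<close>

definition len :: "nat \<Rightarrow> nat set \<Rightarrow> real" where
  "len s S = real s - real (card S)"

text \<open>The conditional mean of \<open>X\<close> given the number of parts, by the reflection of
  the interval.\<close>

definition mid :: "nat \<Rightarrow> nat set \<Rightarrow> real" where
  "mid s S = real (card S) * (len s S + 1) / 2"

text \<open>The weight 1/(2n) is the normalisation under which the average becomes that of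
  \<open>(X S - mid s S) * f (X S)\<close>.\<close>

definition swap_form :: "nat \<Rightarrow> (real \<Rightarrow> real) \<Rightarrow> nat set \<Rightarrow> real" where
  "swap_form s f S = 1 / (2 * len s S) *
     (\<Sum>i\<in>S. \<Sum>j\<in>gaps s S. (real j - real i) * (f (X S + (real j - real i)) - f (X S)))"

definition size_form :: "nat \<Rightarrow> (real \<Rightarrow> real) \<Rightarrow> nat set \<Rightarrow> real" where
  "size_form s f S = (len s S + 1) * (\<Sum>t\<in>S. f (X S) - f (X S - real t))
     - (real s - 2 * real (card S) - 1) * (\<Sum>x\<in>gaps s S. f (X S) - f (X S - num_above x S))"

text \<open>The factor \<open>1/10\<close> comes from the identity \<open>drift = 10 * mid - 6 * k - (s\<^sup>2 - s)\<close>, in which the term linear in \<open>k\<close> is negligible.\<close>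

definition stein_form :: "nat \<Rightarrow> (real \<Rightarrow> real) \<Rightarrow> nat set \<Rightarrow> real" where
  "stein_form s f S = swap_form s f S + size_form s f S / 10"

text \<open>Death rate minus birth rate of a reversible birth-death chain for the number \<open>k\<close> of parts: \<open>c\<^sub>k = (s - k choose k)\<close> satisfies \<open>c\<^sub>k (s - 2k) (s - 2k - 1) = c\<^sub>k\<^sub>+\<^sub>1 (k + 1) (s - k)\<close>.\<close>

definition drift :: "real \<Rightarrow> real \<Rightarrow> real" where
  "drift s k = k * (s - k + 1) - (s - 2 * k) * (s - 2 * k - 1)"

lemma Om_real_bounds:
  assumes "S \<in> Om s" "s > 0"
  shows "0 \<le> real (card S)" "2 * real (card S) \<le> real s" "real s / 2 \<le> len s S" "len s S \<le> real s"
    "len s S > 0" "real (s - card S) = len s S" "1 \<le> real s"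
proof -
  have "real (2 * card S) \<le> real s" unfolding of_nat_le_iff by (rule OmD(3)[OF assms(1)])
  then show "0 \<le> real (card S)" "2 * real (card S) \<le> real s" "real s / 2 \<le> len s S" "len s S \<le> real s"
    "len s S > 0" "real (s - card S) = len s S" "1 \<le> real s"
    using assms(2) OmD(4)[OF assms(1)] by (auto simp: len_def)
qed

text \<open>The weight 1/(2n) in \<open>swap_identity\<close> leaves \<open>F\<close> tested against
  the deviation of the sum of \<open>g\<close> over the parts from its conditional mean given their
  number.\<close>

lemma swap_av:
  fixes g :: "nat \<Rightarrow> real"
  assumes "s > 0"
  shows "av s (\<lambda>S. 1 / (2 * len s S) * (\<Sum>i\<in>S. \<Sum>j\<in>gaps s S. (g j - g i) * (F (insert j (S - {i})) - F S))) =
    av s (\<lambda>S. ((\<Sum>i\<in>S. g i) - real (card S) * (\<Sum>i=1..s - card S. g i) / len s S) * F S)"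
proof -
  have "(\<Sum>S\<in>Om s. 1 / (2 * len s S) * (\<Sum>i\<in>S. \<Sum>j\<in>gaps s S. (g j - g i) * (F (insert j (S - {i})) - F S))) =
    2 * (\<Sum>S\<in>Om s. 1 / (2 * len s S) * (real (s - card S) * (\<Sum>i\<in>S. g i)
        - real (card S) * (\<Sum>i=1..s - card S. g i)) * F S)"
    unfolding len_def by (rule swap_identity[where w = "\<lambda>k. 1 / (2 * (real s - real k))"])
  also have "\<dots> = (\<Sum>S\<in>Om s. ((\<Sum>i\<in>S. g i) - real (card S) * (\<Sum>i=1..s - card S. g i) / len s S) * F S)"
    unfolding sum_distrib_left[of _ _ "Om s"]
  proof (intro sum.cong refl)
    fix S assume S: "S \<in> Om s"
    show "2 * (1 / (2 * len s S) * (real (s - card S) * sum g S - real (card S) * sum g {1..s - card S}) * F S) =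
         (sum g S - real (card S) * sum g {1..s - card S} / len s S) * F S"
      unfolding Om_real_bounds(6)[OF S assms] using Om_real_bounds(5)[OF S assms] by (simp add: field_simps)
  qed
  finally show ?thesis unfolding av_def by simp
qed

lemma sum_real_upto: "(\<Sum>i=1..n. real i) = real n * (real n + 1) / 2"
  by (induction n) (auto simp: field_simps)

lemma sum_real_squares_upto: "(\<Sum>i=1..n. (real i)\<^sup>2) = real n * (real n + 1) * (2 * real n + 1) / 6"
  by (induction n) (auto simp: field_simps power2_eq_square)

lemma av_swap_form:
  assumes "s > 0"
  shows "av s (swap_form s f) = av s (\<lambda>S. (X S - mid s S) * f (X S))"
proof -
  have "av s (swap_form s f) = av s (\<lambda>S. 1 / (2 * len s S) *
      (\<Sum>i\<in>S. \<Sum>j\<in>gaps s S. (real j - real i) * (f (X (insert j (S - {i}))) - f (X S))))"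
    unfolding swap_form_def using OmD(1)
    by (intro av_cong arg_cong2[where f = "(*)"] sum.cong refl) (simp add: X_exchange)
  also have "\<dots> = av s (\<lambda>S. ((\<Sum>i\<in>S. real i) - real (card S) * (\<Sum>i=1..s - card S. real i) / len s S) * f (X S))"
    by (rule swap_av[OF assms, where F = "\<lambda>S. f (X S)"])
  also have "\<dots> = av s (\<lambda>S. (X S - mid s S) * f (X S))"
  proof (rule av_cong)
    fix S assume S: "S \<in> Om s"
    show "((\<Sum>i\<in>S. real i) - real (card S) * (\<Sum>i=1..s - card S. real i) / len s S) * f (X S) = (X S - mid s S) * f (X S)"
      unfolding sum_real_upto Om_real_bounds(6)[OF S assms]
      using Om_real_bounds(5)[OF S assms] by (simp add: X_def mid_def)
  qed
  finally show ?thesis .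
qed

lemma birth_death_av:
  fixes F :: "nat \<Rightarrow> real \<Rightarrow> real"
  assumes "s > 0"
  shows "av s (\<lambda>S. (len s S + 1) * (\<Sum>t\<in>S. F (card S) (X S - real t))) =
    av s (\<lambda>S. (real s - 2 * real (card S) - 1) * (\<Sum>x\<in>gaps s S. F (Suc (card S)) (X S - num_above x S)))"
  unfolding av_def len_def using birth_death_identity[OF assms, of F] by simp

text \<open>The values of \<open>f\<close> at shifted arguments cancel on average by the birth-death
  identity. What remains is \<open>f (X S)\<close> times k(n + 1) for the parts minus (s - 2k)(s -
  2k - 1) for the gaps, which is \<open>drift\<close>.\<close>

lemma av_size_form:
  assumes "s > 0"
  shows "av s (size_form s f) = av s (\<lambda>S. drift s (card S) * f (X S))"
proof -
  have eq: "size_form s f S = drift s (card S) * f (X S)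
      - ((len s S + 1) * (\<Sum>t\<in>S. f (X S - real t))
         - (real s - 2 * real (card S) - 1) * (\<Sum>x\<in>gaps s S. f (X S - num_above x S)))" if S: "S \<in> Om s" for S
  proof -
    have "(\<Sum>x\<in>gaps s S. f (X S) - f (X S - num_above x S)) =
        (real s - 2 * real (card S)) * f (X S) - (\<Sum>x\<in>gaps s S. f (X S - num_above x S))"
      unfolding sum_subtractf sum_constant OmD(5)[OF S] by simp
    moreover have "(\<Sum>t\<in>S. f (X S) - f (X S - real t)) = real (card S) * f (X S) - (\<Sum>t\<in>S. f (X S - real t))"
      by (simp add: sum_subtractf)
    ultimately show ?thesis unfolding size_form_def drift_def len_def
      by (simp only:) (simp only: algebra_simps)
  qed
  have "av s (size_form s f) = av s (\<lambda>S. drift s (card S) * f (X S)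
      - ((len s S + 1) * (\<Sum>t\<in>S. f (X S - real t))
         - (real s - 2 * real (card S) - 1) * (\<Sum>x\<in>gaps s S. f (X S - num_above x S))))"
    by (rule av_cong) (rule eq)
  also have "\<dots> = av s (\<lambda>S. drift s (card S) * f (X S))"
    unfolding av_diff using birth_death_av[OF assms, of "\<lambda>_. f"] by simp
  finally show ?thesis .
qed

text \<open>With the drift itself as test function, the birth-death identity turns its second moment
  into the mean of the birth rate \<open>?A\<close>, at most the square of s, times the increment of
  the drift, at most 5s.\<close>

lemma av_drift_sq_le:
  assumes "s > 0"
  shows "av s (\<lambda>S. (drift s (card S))\<^sup>2) \<le> 5 * real s ^ 3"
proof -
  let ?A = "\<lambda>k. (real s - 2 * k) * (real s - 2 * k - 1)"
  have "av s (\<lambda>S. (len s S + 1) * (\<Sum>t\<in>S. drift s (card S))) =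
      av s (\<lambda>S. (real s - 2 * real (card S) - 1) * (\<Sum>x\<in>gaps s S. drift s (Suc (card S))))"
    by (rule birth_death_av[OF assms, of "\<lambda>k _. drift s k"])
  \<comment> \<open>The death rate k(n + 1) is the drift plus the birth rate.\<close>
  also have "av s (\<lambda>S. (len s S + 1) * (\<Sum>t\<in>S. drift s (card S))) =
      av s (\<lambda>S. (drift s (card S))\<^sup>2 + ?A (card S) * drift s (card S))"
    by (rule av_cong) (simp add: len_def drift_def power2_eq_square algebra_simps)
  also have "av s (\<lambda>S. (real s - 2 * real (card S) - 1) * (\<Sum>x\<in>gaps s S. drift s (Suc (card S)))) =
      av s (\<lambda>S. ?A (card S) * drift s (Suc (card S)))"
    by (rule av_cong) (simp only: sum_constant OmD(5) mult_ac)
  finally have "av s (\<lambda>S. (drift s (card S))\<^sup>2) = av s (\<lambda>S. ?A (card S) * drift s (Suc (card S))) - av s (\<lambda>S. ?A (card S) * drift s (card S))"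
    unfolding av_add by simp
  also have "\<dots> = av s (\<lambda>S. ?A (card S) * (drift s (Suc (card S)) - drift s (card S)))"
    unfolding av_diff[symmetric] by (simp only: right_diff_distrib)
  also have "\<dots> \<le> av s (\<lambda>S. 5 * real s ^ 3)"
  proof (rule av_mono)
    \<comment> \<open>Integrality of s - 2k is what makes the birth rate d(d - 1)
      nonnegative.\<close>
    fix S assume S: "S \<in> Om s"
    define d where "d = s - 2 * card S"
    have d: "real s - 2 * real (card S) = real d" using OmD(3)[OF S] by (simp add: d_def of_nat_diff)
    have ds: "real d \<le> real s" by (simp add: d_def)
    have A: "?A (card S) = real d * (real d - 1)" unfolding d by simp
    have A0: "0 \<le> ?A (card S)" unfolding A by (cases d) auto
    have "real d * (real d - 1) \<le> real d * real d" by (simp add: algebra_simps)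
    also have "\<dots> \<le> real s * real s" using ds by (intro mult_mono) auto
    finally have A1: "?A (card S) \<le> real s * real s" unfolding A .
    have "drift s (Suc (card S)) - drift s (card S) = 5 * (real s - 2 * real (card S)) - 6"
      by (simp add: drift_def algebra_simps)
    also have "\<dots> \<le> 5 * real s" unfolding d using ds by simp
    finally have "?A (card S) * (drift s (Suc (card S)) - drift s (card S)) \<le> ?A (card S) * (5 * real s)"
      using A0 by (rule mult_left_mono)
    also have "\<dots> \<le> real s * real s * (5 * real s)" using A1 by (intro mult_right_mono) auto
    finally show "?A (card S) * (drift s (Suc (card S)) - drift s (card S)) \<le> 5 * real s ^ 3"
      by (simp add: power3_eq_cube algebra_simps)
  qed
  finally show ?thesis by simp
qed

text \<open>Adding a tenth of the drift to X - \<open>mid\<close> cancels all quadratic dependence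
  on k and leaves X - 3k/5 minus a constant.\<close>

lemma stein_identity:
  assumes "s > 0"
  defines "\<mu> \<equiv> av s X" and "\<nu> \<equiv> av s (\<lambda>S. real (card S))"
  shows "av s (\<lambda>S. (X S - \<mu>) * f (X S)) =
    av s (stein_form s f) + 3 / 5 * av s (\<lambda>S. (real (card S) - \<nu>) * f (X S))"
proof -
  have drift: "drift s (card S) = 10 * mid s S - 6 * real (card S) - (real s * real s - real s)" for S
    by (simp add: drift_def mid_def len_def field_simps)
  \<comment> \<open>Testing with a constant function shows that \<open>mid\<close> has mean \<mu>
    and the drift has mean 0, which determines the constant.\<close>
  have "swap_form s (\<lambda>_. 1) = (\<lambda>_. 0)" "size_form s (\<lambda>_. 1) = (\<lambda>_. 0)"
    by (auto simp: swap_form_def size_form_def)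
  then have "av s (swap_form s (\<lambda>_. 1)) = 0" "av s (size_form s (\<lambda>_. 1)) = 0"
    by simp_all
  then have "\<mu> = av s (mid s)" "av s (\<lambda>S. drift s (card S)) = 0"
    using av_swap_form[OF assms(1), of "\<lambda>_. 1"] av_size_form[OF assms(1), of "\<lambda>_. 1"]
    by (simp_all add: av_diff \<mu>_def)
  then have c: "real s * real s - real s = 10 * \<mu> - 6 * \<nu>"
    unfolding drift av_diff av_cmult by (simp add: \<nu>_def)
  have "av s (stein_form s f) = av s (\<lambda>S. (X S - mid s S) * f (X S)) + 1 / 10 * av s (\<lambda>S. drift s (card S) * f (X S))"
    unfolding stein_form_def av_add using av_swap_form[OF assms(1), of f] av_size_form[OF assms(1), of f]
      av_cmult[of s "1/10" "size_form s f"] by simp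
  then have "av s (stein_form s f) + 3 / 5 * av s (\<lambda>S. (real (card S) - \<nu>) * f (X S)) =
      av s (\<lambda>S. ((X S - mid s S) * f (X S) + 1 / 10 * (drift s (card S) * f (X S))) + 3 / 5 * ((real (card S) - \<nu>) * f (X S)))"
    unfolding av_add av_cmult by simp
  also have "\<dots> = av s (\<lambda>S. (X S - \<mu>) * f (X S))"
    by (rule av_cong) (simp add: drift c field_simps)
  finally show ?thesis by simp
qed

text \<open>Every move displaces \<open>X\<close> by at most s. The total weight is a quarter of
  \<open>(real s)\<^sup>2\<close> for exchanges and at most \<open>(real s)\<^sup>2\<close> for each
  half of the size form, which enters with factor 1/10.\<close>

lemma abs_stein_form_le:
  assumes S: "S \<in> Om s" and s: "s > 0"
    and e: "\<And>u. \<bar>u\<bar> \<le> real s \<Longrightarrow> \<bar>f (X S + u) - f (X S)\<bar> \<le> e"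
  shows "\<bar>stein_form s f S\<bar> \<le> (real s)\<^sup>2 * e"
proof -
  note B = Om_real_bounds[OF S s] and D = OmD[OF S]
  have e0: "0 \<le> e" using e[of 0] by simp
  have le: "real i \<le> len s S" "1 \<le> real i" if "i \<in> {1..s - card S}" for i
    using that B(6) by auto
  have "\<bar>\<Sum>i\<in>S. \<Sum>j\<in>gaps s S. (real j - real i) * (f (X S + (real j - real i)) - f (X S))\<bar>
      \<le> (\<Sum>i\<in>S. \<Sum>j\<in>gaps s S. len s S * e)"
  proof (rule order_trans[OF sum_abs], rule sum_mono, rule order_trans[OF sum_abs], rule sum_mono)
    fix i j assume i: "i \<in> S" and j: "j \<in> gaps s S"
    have "\<bar>real j - real i\<bar> \<le> len s S" using le[of i] le[of j] i j D(2) by auto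
    then show "\<bar>(real j - real i) * (f (X S + (real j - real i)) - f (X S))\<bar> \<le> len s S * e"
      unfolding abs_mult using B by (intro mult_mono e) auto
  qed
  also have "\<dots> = real (card S) * (real s - 2 * real (card S)) * (len s S * e)"
    unfolding sum_constant OmD(5)[OF S] by simp
  finally have "\<bar>swap_form s f S\<bar> \<le> 1 / (2 * len s S) * (real (card S) * (real s - 2 * real (card S)) * (len s S * e))"
    unfolding swap_form_def abs_mult using B by (intro mult_mono) auto
  also have "\<dots> = (real (card S) * (real s - 2 * real (card S))) * e / 2" using B by simp
  also have "\<dots> \<le> (real s / 2 * real s) * e / 2"
    using B e0 by (intro divide_right_mono mult_right_mono mult_mono) auto
  finally have 1: "\<bar>swap_form s f S\<bar> \<le> (real s)\<^sup>2 * e / 4" by (simp add: power2_eq_square)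
  have "\<bar>\<Sum>t\<in>S. f (X S) - f (X S - real t)\<bar> \<le> (\<Sum>t\<in>S. e)"
  proof (rule order_trans[OF sum_abs], rule sum_mono)
    fix t assume "t \<in> S"
    then have "real t \<le> len s S" using le[of t] D(2) by blast
    then have "\<bar>- real t\<bar> \<le> real s" using B(4) by linarith
    from e[OF this] show "\<bar>f (X S) - f (X S - real t)\<bar> \<le> e" by (simp add: abs_minus_commute)
  qed
  also have "\<dots> \<le> real s / 2 * e" unfolding sum_constant using B e0 by (intro mult_right_mono) auto
  finally have "(len s S + 1) * \<bar>\<Sum>t\<in>S. f (X S) - f (X S - real t)\<bar> \<le> (2 * real s) * (real s / 2 * e)"
    using B e0 by (intro mult_mono) auto
  then have 2: "\<bar>(len s S + 1) * (\<Sum>t\<in>S. f (X S) - f (X S - real t))\<bar> \<le> (real s)\<^sup>2 * e"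
    using B by (simp add: abs_mult power2_eq_square)
  have "\<bar>\<Sum>x\<in>gaps s S. f (X S) - f (X S - num_above x S)\<bar> \<le> (\<Sum>x\<in>gaps s S. e)"
  proof (rule order_trans[OF sum_abs], rule sum_mono)
    fix x assume "x \<in> gaps s S"
    have "card {y \<in> S. x < y} \<le> card S" using D(1) by (intro card_mono) auto
    then have "num_above x S \<le> real (card S)" "0 \<le> num_above x S" by (simp_all add: num_above_def)
    then have "\<bar>- num_above x S\<bar> \<le> real s" using B by auto
    from e[OF this] show "\<bar>f (X S) - f (X S - num_above x S)\<bar> \<le> e" by (simp add: abs_minus_commute)
  qed
  also have "\<dots> = (real s - 2 * real (card S)) * e" unfolding sum_constant OmD(5)[OF S] by simp
  also have "\<dots> \<le> real s * e" using B e0 by (intro mult_right_mono) auto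
  finally have "\<bar>real s - 2 * real (card S) - 1\<bar> * \<bar>\<Sum>x\<in>gaps s S. f (X S) - f (X S - num_above x S)\<bar> \<le> real s * (real s * e)"
    using B e0 by (intro mult_mono) auto
  then have 3: "\<bar>(real s - 2 * real (card S) - 1) * (\<Sum>x\<in>gaps s S. f (X S) - f (X S - num_above x S))\<bar> \<le> (real s)\<^sup>2 * e"
    by (simp add: abs_mult power2_eq_square)
  have "0 \<le> (real s)\<^sup>2 * e" using e0 by simp
  moreover have "\<bar>a + (b - c) / 10\<bar> \<le> M" if "\<bar>a\<bar> \<le> M / 4" "\<bar>b\<bar> \<le> M" "\<bar>c\<bar> \<le> M" "0 \<le> M" for a b c M :: real
    using that by (auto simp: abs_le_iff field_simps)
  ultimately show ?thesis unfolding stein_form_def size_form_def using 1 2 3 by blast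
qed

text \<open>The coefficient of the derivative when \<open>f\<close> is linearised
  (\<open>stein_form_approx\<close>); its mean is close to the variance
  (\<open>variance_quad\<close>).\<close>

definition quad :: "nat \<Rightarrow> nat set \<Rightarrow> real" where
  "quad s S = stein_form s (\<lambda>x. x) S"

lemma stein_form_linear: "stein_form s (\<lambda>x. f x - p * x) S = stein_form s f S - p * quad s S"
proof -
  have swap: "swap_form s (\<lambda>x. f x - p * x) S = swap_form s f S - p * swap_form s (\<lambda>x. x) S"
    unfolding swap_form_def sum_distrib_left sum_subtractf[symmetric]
    by (intro sum.cong refl) (simp only: algebra_simps)
  have diff: "(\<Sum>y\<in>A. (f (X S) - p * X S) - (f (X S - h y) - p * (X S - h y))) =
      (\<Sum>y\<in>A. f (X S) - f (X S - h y)) - p * (\<Sum>y\<in>A. X S - (X S - h y))" for A and h :: "nat \<Rightarrow> real"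
    unfolding sum_distrib_left sum_subtractf[symmetric]
    by (intro sum.cong refl) (simp only: algebra_simps)
  have "size_form s (\<lambda>x. f x - p * x) S = size_form s f S - p * size_form s (\<lambda>x. x) S"
    unfolding size_form_def diff by (simp only: algebra_simps)
  with swap show ?thesis
    unfolding quad_def stein_form_def by (simp add: field_simps)
qed

lemma stein_form_approx:
  assumes "S \<in> Om s" "s > 0"
    and "\<And>u. \<bar>u\<bar> \<le> real s \<Longrightarrow> \<bar>f (X S + u) - f (X S) - u * p\<bar> \<le> e"
  shows "\<bar>stein_form s f S - p * quad s S\<bar> \<le> (real s)\<^sup>2 * e"
  unfolding stein_form_linear[symmetric]
  by (rule abs_stein_form_le[OF assms(1,2)]) (use assms(3) in \<open>simp add: algebra_simps\<close>)

section \<open>Concentration of the quadratic form\<close>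

text \<open>The root of the leading part \<open>5k(s - k) - s\<^sup>2\<close> of the drift, around which the number of parts concentrates.\<close>

definition kap :: "nat \<Rightarrow> real" where
  "kap s = real s * (1 - 1 / sqrt 5) / 2"

lemma kap_bounds:
  shows "kap s * (real s - kap s) = (real s)\<^sup>2 / 5" "27 / 100 * real s \<le> kap s" "kap s \<le> 28 / 100 * real s"
proof -
  define r where "r = 1 / sqrt (5::real)"
  have r2: "r\<^sup>2 = 1 / 5" "0 \<le> r" by (simp_all add: r_def power_divide)
  have k: "kap s = real s * (1 - r) / 2" by (simp add: kap_def r_def)
  have "kap s * (real s - kap s) = (real s)\<^sup>2 * (1 - r\<^sup>2) / 4"
    unfolding k by (simp add: power2_eq_square field_simps)
  then show "kap s * (real s - kap s) = (real s)\<^sup>2 / 5" unfolding r2 by simp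
  \<comment> \<open>The bounds 0.44 and 0.46 on 1/sqrt 5 become 0.28 and 0.27 for (1 - r)/2.\<close>
  have "r \<le> 46 / 100" by (rule power2_le_imp_le) (simp_all add: r2 power_divide)
  moreover have "44 / 100 \<le> r" by (rule power2_le_imp_le) (simp_all add: r2 power_divide)
  ultimately have "real s * (54 / 100) \<le> real s * (1 - r)" "real s * (1 - r) \<le> real s * (56 / 100)"
    by (intro mult_left_mono; simp)+
  then show "27 / 100 * real s \<le> kap s" "kap s \<le> 28 / 100 * real s" unfolding k by auto
qed

text \<open>Since \<open>kap\<close> is a root of the leading part, the difference factors through
  k(s - k) - kap(s - kap) = (k - kap)(s - k - kap). This converts the bound on the drift into one on
  k.\<close>

lemma drift_at_kap: "drift s k - (real s - kap s) = (k - kap s) * (5 * (real s - k - kap s) - 1)"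
proof -
  have "drift s k = 5 * (k * (real s - k)) - k - (real s)\<^sup>2 + real s"
    by (simp add: drift_def power2_eq_square algebra_simps)
  also have "(real s)\<^sup>2 = 5 * (kap s * (real s - kap s))" by (simp add: kap_bounds(1))
  finally show ?thesis by (simp add: algebra_simps)
qed

lemma av_card_variance_le:
  assumes "s \<ge> 10"
  shows "av s (\<lambda>S. (real (card S) - kap s)\<^sup>2) \<le> 12 * real s"
proof -
  have s: "s > 0" "10 \<le> real s" using assms by auto
  have "av s (\<lambda>S. (real s)\<^sup>2 * (real (card S) - kap s)\<^sup>2) \<le> av s (\<lambda>S. 2 * (drift s (card S))\<^sup>2 + 2 * (real s)\<^sup>2)"
  proof (rule av_mono)
    fix S assume S: "S \<in> Om s"
    let ?k = "real (card S)"
    \<comment> \<open>From k \<le> s/2 and kap \<le> 0.28 s the right side is at least 1.1 s - 1,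
      and s \<ge> 10 absorbs the 1.\<close>
    have "1 * real s \<le> 5 * (real s - ?k - kap s) - 1"
      using Om_real_bounds(2)[OF S s(1)] kap_bounds(3)[of s] s(2) by (simp add: field_simps)
    then have "\<bar>?k - kap s\<bar> * real s \<le> \<bar>?k - kap s\<bar> * \<bar>5 * (real s - ?k - kap s) - 1\<bar>"
      by (intro mult_left_mono) auto
    also have "\<dots> = \<bar>drift s ?k - (real s - kap s)\<bar>" unfolding drift_at_kap by (simp add: abs_mult)
    also have "\<dots> \<le> \<bar>drift s ?k\<bar> + real s"
      using kap_bounds(2,3)[of s] s(2) by linarith
    finally have "(\<bar>?k - kap s\<bar> * real s)\<^sup>2 \<le> (\<bar>drift s ?k\<bar> + real s)\<^sup>2"
      by (intro power_mono) auto
    also have "\<dots> \<le> 2 * (drift s ?k)\<^sup>2 + 2 * (real s)\<^sup>2"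
      using zero_le_power2[of "\<bar>drift s ?k\<bar> - real s"] by (simp add: power2_sum power2_diff)
    finally show "(real s)\<^sup>2 * (?k - kap s)\<^sup>2 \<le> 2 * (drift s ?k)\<^sup>2 + 2 * (real s)\<^sup>2"
      by (simp add: power_mult_distrib mult.commute)
  qed
  also have "\<dots> \<le> 2 * (5 * real s ^ 3) + 2 * (real s)\<^sup>2"
    unfolding av_add av_cmult using av_drift_sq_le[OF s(1)] by simp
  also have "\<dots> = (real s)\<^sup>2 * (10 * real s + 2)" by (simp add: power2_eq_square power3_eq_cube algebra_simps)
  finally have "(real s)\<^sup>2 * av s (\<lambda>S. (real (card S) - kap s)\<^sup>2) \<le> (real s)\<^sup>2 * (10 * real s + 2)"
    unfolding av_cmult .
  then have "av s (\<lambda>S. (real (card S) - kap s)\<^sup>2) \<le> 10 * real s + 2"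
    using s(1) by simp
  then show ?thesis using s by simp
qed

text \<open>A window around \<open>kap\<close> with margin 0.07 s on which there are at least s/5
  parts and at least s/5 gaps.\<close>

definition bulk :: "nat \<Rightarrow> nat set \<Rightarrow> bool" where
  "bulk s S \<longleftrightarrow> real s / 5 \<le> real (card S) \<and> real (card S) \<le> 2 * real s / 5"

text \<open>Chebyshev's inequality with the margin 0.07 s; the constant is 12 / 0.0049 <
  2500.\<close>

lemma av_not_bulk_le:
  assumes "s \<ge> 10"
  shows "av s (\<lambda>S. of_bool (\<not> bulk s S)) \<le> 2500 / real s"
proof -
  have s: "s > 0" using assms by simp
  have "av s (\<lambda>S. of_bool (\<not> bulk s S)) \<le> av s (\<lambda>S. 1 / (49 / 10000 * (real s)\<^sup>2) * (real (card S) - kap s)\<^sup>2)"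
  proof (rule av_mono)
    fix S assume "S \<in> Om s"
    show "of_bool (\<not> bulk s S) \<le> 1 / (49 / 10000 * (real s)\<^sup>2) * (real (card S) - kap s)\<^sup>2"
    proof (cases "bulk s S")
      case False
      then have "7 / 100 * real s \<le> \<bar>real (card S) - kap s\<bar>"
        using kap_bounds(2,3)[of s] unfolding bulk_def by linarith
      then have "(7 / 100 * real s)\<^sup>2 \<le> \<bar>real (card S) - kap s\<bar>\<^sup>2" by (intro power_mono) auto
      then show ?thesis using s False by (simp add: power_mult_distrib power2_eq_square field_simps)
    qed simp
  qed
  also have "\<dots> \<le> 1 / (49 / 10000 * (real s)\<^sup>2) * (12 * real s)"
    unfolding av_cmult by (intro mult_left_mono av_card_variance_le[OF assms]) auto
  also have "\<dots> \<le> 2500 / real s" using s by (simp add: power2_eq_square field_simps)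
  finally show ?thesis .
qed

section \<open>Lower bound on the exchange form and variances of sums over the parts\<close>

definition sqdiff :: "nat \<Rightarrow> nat set \<Rightarrow> real" where
  "sqdiff s S = (\<Sum>i\<in>S. \<Sum>j\<in>gaps s S. (real j - real i)\<^sup>2)"

text \<open>At most s/10 gaps lie within distance s div 20 of a given part, so at least s/10 of the
  s/5 gaps are at distance s/20 or more. Summing over at least s/5 parts gives the constant.\<close>

lemma sqdiff_bulk:
  assumes S: "S \<in> Om s" and s: "s > 0" and b: "bulk s S"
  shows "real s ^ 4 / 20000 \<le> sqdiff s S"
proof -
  define r where "r = s div 20"
  have r: "real r \<le> real s / 20" "real s / 20 \<le> real r + 1"
    unfolding r_def by linarith+
  have each: "real s / 10 * (real s / 20)\<^sup>2 \<le> (\<Sum>j\<in>gaps s S. (real j - real i)\<^sup>2)" if i: "i \<in> S" for i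
  proof -
    let ?N = "{i - r..i + r} - {i}"
    have "card ?N = card {i - r..i + r} - 1" by simp
    also have "\<dots> \<le> 2 * r" by simp
    finally have N: "real (card ?N) \<le> 2 * real r" by linarith
    have "card (gaps s S) - card ?N \<le> card (gaps s S - ?N)" by (rule diff_card_le_card_Diff) simp
    then have "real (card (gaps s S)) - real (card ?N) \<le> real (card (gaps s S - ?N))" by linarith
    then have c: "real s / 10 \<le> real (card (gaps s S - ?N))"
      using OmD(5)[OF S] N r(1) b unfolding bulk_def by linarith
    have "real s / 10 * (real s / 20)\<^sup>2 \<le> real (card (gaps s S - ?N)) * (real s / 20)\<^sup>2"
      using c by (intro mult_right_mono) auto
    also have "\<dots> = (\<Sum>j\<in>gaps s S - ?N. (real s / 20)\<^sup>2)" by simp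
    also have "\<dots> \<le> (\<Sum>j\<in>gaps s S - ?N. (real j - real i)\<^sup>2)"
    proof (rule sum_mono)
      fix j assume j: "j \<in> gaps s S - ?N"
      then have "j \<noteq> i" using i by auto
      then have "j < i - r \<or> i + r < j" using j by auto
      then have "real r + 1 \<le> \<bar>real j - real i\<bar>" by linarith
      then have "(real s / 20)\<^sup>2 \<le> \<bar>real j - real i\<bar>\<^sup>2" using r(2) by (intro power_mono) auto
      then show "(real s / 20)\<^sup>2 \<le> (real j - real i)\<^sup>2" by simp
    qed
    also have "\<dots> \<le> (\<Sum>j\<in>gaps s S. (real j - real i)\<^sup>2)"
      by (rule sum_mono2) auto
    finally show ?thesis .
  qed
  have "real s / 5 * (real s / 10 * (real s / 20)\<^sup>2) \<le> real (card S) * (real s / 10 * (real s / 20)\<^sup>2)"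
    using b by (intro mult_right_mono) (auto simp: bulk_def)
  also have "\<dots> \<le> sqdiff s S"
    unfolding sqdiff_def by (rule sum_bounded_below[OF each])
  finally show ?thesis by (simp add: power2_eq_square power4_eq_xxxx)
qed

lemma swap_form_id: "swap_form s (\<lambda>x. x) S = sqdiff s S / (2 * len s S)"
  by (simp add: swap_form_def sqdiff_def power2_eq_square)

lemma sqdiff_nonneg: "0 \<le> sqdiff s S"
  by (simp add: sqdiff_def sum_nonneg)

lemma swap_form_id_bulk:
  assumes "S \<in> Om s" "s > 0" "bulk s S"
  shows "real s ^ 3 / 40000 \<le> swap_form s (\<lambda>x. x) S"
proof -
  note B = Om_real_bounds[OF assms(1,2)]
  have "real s ^ 3 / 40000 * (2 * len s S) \<le> real s ^ 3 / 40000 * (2 * real s)"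
    using B by (intro mult_left_mono) auto
  also have "\<dots> = real s ^ 4 / 20000" by (simp add: power3_eq_cube power4_eq_xxxx)
  also have "\<dots> \<le> sqdiff s S" by (rule sqdiff_bulk[OF assms])
  finally show ?thesis unfolding swap_form_id using B by (simp add: pos_le_divide_eq mult.commute)
qed

text \<open>The centred sum is tested against itself in \<open>swap_av\<close>. Its centring depends
  only on the number of parts, so an exchange changes it by \<open>g j - g i\<close> exactly, and
  its second moment is a weighted sum of squares of such differences.\<close>

lemma av_centred_sum_sq_le:
  fixes g :: "nat \<Rightarrow> real"
  assumes s: "s > 0" and g: "\<And>i. i \<le> s \<Longrightarrow> 0 \<le> g i \<and> g i \<le> c"
  shows "av s (\<lambda>S. ((\<Sum>i\<in>S. g i) - real (card S) * (\<Sum>i=1..s - card S. g i) / len s S)\<^sup>2) \<le> real s * c\<^sup>2"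
proof -
  let ?c = "\<lambda>S. real (card S) * (\<Sum>i=1..s - card S. g i) / len s S"
  let ?F = "\<lambda>S. (\<Sum>i\<in>S. g i) - ?c S"
  have "av s (\<lambda>S. (?F S)\<^sup>2) = av s (\<lambda>S. ?F S * ?F S)" by (simp add: power2_eq_square)
  also have "\<dots> = av s (\<lambda>S. 1 / (2 * len s S) * (\<Sum>i\<in>S. \<Sum>j\<in>gaps s S. (g j - g i) * (?F (insert j (S - {i})) - ?F S)))"
    by (rule swap_av[OF s, symmetric])
  also have "\<dots> \<le> av s (\<lambda>S. real s * c\<^sup>2)"
  proof (rule av_mono)
    fix S assume S: "S \<in> Om s"
    note B = Om_real_bounds[OF S s]
    have "(\<Sum>i\<in>S. \<Sum>j\<in>gaps s S. (g j - g i) * (?F (insert j (S - {i})) - ?F S)) \<le> (\<Sum>i\<in>S. \<Sum>j\<in>gaps s S. c\<^sup>2)"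
    proof (intro sum_mono)
      fix i j assume i: "i \<in> S" and j: "j \<in> gaps s S"
      have card: "card (insert j (S - {i})) = card S" using OmD(1)[OF S] i j by (intro card_exchange) auto
      have "(\<Sum>x\<in>insert j (S - {i}). g x) = (\<Sum>x\<in>S. g x) + (g j - g i)"
        using OmD(1)[OF S] i j by (simp add: sum_diff1)
      then have "?F (insert j (S - {i})) - ?F S = g j - g i" unfolding card len_def by simp
      moreover have "\<bar>g j - g i\<bar> \<le> c"
      proof -
        have "i \<le> s" "j \<le> s" using i j OmD(2)[OF S] by fastforce+
        then show ?thesis using g[of i] g[of j] by auto
      qed
      then have "\<bar>g j - g i\<bar>\<^sup>2 \<le> c\<^sup>2" by (intro power_mono) auto
      ultimately show "(g j - g i) * (?F (insert j (S - {i})) - ?F S) \<le> c\<^sup>2"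
        by (simp add: power2_eq_square)
    qed
    also have "\<dots> = real (card S) * (real s - 2 * real (card S)) * c\<^sup>2"
      unfolding sum_constant OmD(5)[OF S] by simp
    also have "\<dots> \<le> (real s * (2 * len s S)) * c\<^sup>2"
      using B by (intro mult_right_mono mult_mono) auto
    finally show "1 / (2 * len s S) * (\<Sum>i\<in>S. \<Sum>j\<in>gaps s S. (g j - g i) * (?F (insert j (S - {i})) - ?F S)) \<le> real s * c\<^sup>2"
      using B by (simp add: field_simps)
  qed
  finally show ?thesis by simp
qed

section \<open>Expansion of the quadratic form around a function of the number of parts\<close>

definition xi :: "nat \<Rightarrow> nat set \<Rightarrow> real" where
  "xi s S = X S - mid s S"

text \<open>The subtracted term is the conditional mean of the sum of squares of the parts given
  their number.\<close>

definition eta :: "nat \<Rightarrow> nat set \<Rightarrow> real" where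
  "eta s S = (\<Sum>i\<in>S. (real i)\<^sup>2) - real (card S) * (len s S + 1) * (2 * len s S + 1) / 6"

lemma av_xi_sq_le:
  assumes "s > 0"
  shows "av s (\<lambda>S. (xi s S)\<^sup>2) \<le> (real s * sqrt (real s))\<^sup>2"
proof -
  have "av s (\<lambda>S. (xi s S)\<^sup>2) = av s (\<lambda>S. ((\<Sum>i\<in>S. real i) - real (card S) * (\<Sum>i=1..s - card S. real i) / len s S)\<^sup>2)"
  proof (rule av_cong)
    fix S assume S: "S \<in> Om s"
    show "(xi s S)\<^sup>2 = ((\<Sum>i\<in>S. real i) - real (card S) * (\<Sum>i=1..s - card S. real i) / len s S)\<^sup>2"
      unfolding sum_real_upto Om_real_bounds(6)[OF S assms]
      using Om_real_bounds(5)[OF S assms] by (simp add: xi_def X_def mid_def)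
  qed
  also have "\<dots> \<le> real s * (real s)\<^sup>2" by (rule av_centred_sum_sq_le[OF assms]) auto
  finally show ?thesis by (simp add: power_mult_distrib mult.commute)
qed

lemma av_eta_sq_le:
  assumes "s > 0"
  shows "av s (\<lambda>S. (eta s S)\<^sup>2) \<le> ((real s)\<^sup>2 * sqrt (real s))\<^sup>2"
proof -
  have "av s (\<lambda>S. (eta s S)\<^sup>2) = av s (\<lambda>S. ((\<Sum>i\<in>S. (real i)\<^sup>2) - real (card S) * (\<Sum>i=1..s - card S. (real i)\<^sup>2) / len s S)\<^sup>2)"
  proof (rule av_cong)
    fix S assume S: "S \<in> Om s"
    show "(eta s S)\<^sup>2 = ((\<Sum>i\<in>S. (real i)\<^sup>2) - real (card S) * (\<Sum>i=1..s - card S. (real i)\<^sup>2) / len s S)\<^sup>2"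
      unfolding sum_real_squares_upto Om_real_bounds(6)[OF S assms]
      using Om_real_bounds(5)[OF S assms] by (simp add: eta_def mult.assoc)
  qed
  also have "\<dots> \<le> real s * ((real s)\<^sup>2)\<^sup>2" by (rule av_centred_sum_sq_le[OF assms]) (auto intro: power_mono)
  finally show ?thesis by (simp add: power_mult_distrib mult.commute)
qed

text \<open>Expanding the squares and writing gap sums as full sums minus part sums leaves only the
  first two power sums of the parts. Centring them isolates a leading term depending on k
  alone.\<close>

lemma sqdiff_eq:
  assumes S: "S \<in> Om s" and s: "s > 0"
  defines "k \<equiv> real (card S)" and "n \<equiv> len s S"
  shows "sqdiff s S / (2 * n) = k * (n - k) * (n\<^sup>2 - 1) / (12 * n) + (n - 2 * k) * eta s S / (2 * n)
    - xi s S * (n + 1) * (n - 2 * k) / (2 * n) + (xi s S)\<^sup>2 / n"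
proof -
  note B = Om_real_bounds[OF S s] and D = OmD[OF S]
  define Y where "Y = (\<Sum>i\<in>S. (real i)\<^sup>2)"
  have gs: "(\<Sum>j\<in>gaps s S. h j) = (\<Sum>j=1..s - card S. h j) - sum h S" for h :: "nat \<Rightarrow> real"
    by (rule sum_diff) (use D in auto)
  have cg: "real (card (gaps s S)) = n - k" using D(5) by (simp add: n_def k_def len_def)
  have "sqdiff s S = (\<Sum>i\<in>S. \<Sum>j\<in>gaps s S. (real j)\<^sup>2 - 2 * (real i * real j) + (real i)\<^sup>2)"
    unfolding sqdiff_def by (intro sum.cong refl) (simp add: power2_diff)
  also have "\<dots> = k * (\<Sum>j\<in>gaps s S. (real j)\<^sup>2) - 2 * (\<Sum>i\<in>S. \<Sum>j\<in>gaps s S. real i * real j) + (n - k) * Y"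
    unfolding Y_def
    by (simp only: sum.distrib sum_subtractf sum_constant cg k_def[symmetric] sum_distrib_left)
  also have "(\<Sum>i\<in>S. \<Sum>j\<in>gaps s S. real i * real j) = X S * (\<Sum>j\<in>gaps s S. real j)"
    unfolding X_def by (rule sum_product[symmetric])
  also have "(\<Sum>j\<in>gaps s S. (real j)\<^sup>2) = n * (n + 1) * (2 * n + 1) / 6 - Y"
    unfolding gs sum_real_squares_upto B(6) n_def Y_def ..
  also have "(\<Sum>j\<in>gaps s S. real j) = n * (n + 1) / 2 - X S"
    unfolding gs sum_real_upto B(6) n_def X_def ..
  finally have sq: "sqdiff s S = k * (n * (n + 1) * (2 * n + 1) / 6 - Y) - 2 * (X S * (n * (n + 1) / 2 - X S)) + (n - k) * Y" .
  have X: "X S = xi s S + k * (n + 1) / 2" by (simp add: xi_def mid_def k_def n_def)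
  have Y: "Y = eta s S + k * (n + 1) * (2 * n + 1) / 6" by (simp add: eta_def Y_def k_def n_def)
  have "n > 0" using B by (simp add: n_def)
  then show ?thesis unfolding sq X Y by (simp add: field_simps power2_eq_square)
qed

lemma quad_eq:
  assumes S: "S \<in> Om s" and s: "s > 0"
  defines "k \<equiv> real (card S)" and "n \<equiv> len s S"
  shows "quad s S = sqdiff s S / (2 * n) + ((k + 2) * X S + (real s - 2 * k - 1) * k * (k + 1) / 2) / 10"
proof -
  have "(\<Sum>x\<in>gaps s S. num_above x S) = X S - k * (k + 1) / 2"
    unfolding k_def by (rule sum_above_gaps) (use OmD[OF S] in auto)
  then have "size_form s (\<lambda>x. x) S = (n + 1) * X S - (real s - 2 * k - 1) * (X S - k * (k + 1) / 2)"
    by (simp add: size_form_def n_def k_def X_def)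
  also have "\<dots> = (k + 2) * X S + (real s - 2 * k - 1) * k * (k + 1) / 2"
    by (simp add: n_def k_def len_def field_simps)
  finally show ?thesis unfolding quad_def stein_form_def swap_form_id n_def by simp
qed

text \<open>The size part could be negative only through the -1 in s - 2k - 1, which costs k(k +
  1)/2. As all parts are at least 1, X \<ge> k and (k + 2)X pays for it.\<close>

lemma quad_ge_swap_form:
  assumes S: "S \<in> Om s" and s: "s > 0"
  shows "swap_form s (\<lambda>x. x) S \<le> quad s S"
proof -
  let ?k = "real (card S)"
  note B = Om_real_bounds[OF S s]
  have "(\<Sum>i\<in>S. 1) \<le> X S" unfolding X_def using OmD(2)[OF S] by (intro sum_mono) fastforce
  then have X: "?k \<le> X S" by simp
  have "0 \<le> (real s - 2 * ?k) * (?k * (?k + 1))" using B by (intro mult_nonneg_nonneg) auto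
  moreover have "(?k + 2) * ?k \<le> (?k + 2) * X S" using X by (intro mult_left_mono) auto
  moreover have "0 \<le> ?k * ?k" by simp
  moreover have "(?k + 2) * X S + (real s - 2 * ?k - 1) * ?k * (?k + 1) / 2 =
      ((?k + 2) * X S - (?k + 2) * ?k) + (real s - 2 * ?k) * (?k * (?k + 1)) / 2 + ?k * ?k / 2 + 3 / 2 * ?k"
    by (simp add: field_simps)
  ultimately have "0 \<le> (?k + 2) * X S + (real s - 2 * ?k - 1) * ?k * (?k + 1) / 2"
    using B(1) by linarith
  then show ?thesis unfolding quad_eq[OF S s] swap_form_id by simp
qed

text \<open>The homogeneous cubic part of \<open>quad\<close> once \<open>xi\<close> and
  \<open>eta\<close> are set to 0: exchanges give the first summand, size moves the second.\<close>

definition quad_centre :: "real \<Rightarrow> real \<Rightarrow> real" where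
  "quad_centre s k = k * (s - 2 * k) * (s - k) / 12 + (k\<^sup>2 * (s - k) + (s - 2 * k) * k\<^sup>2) / 20"

lemma quad_centre_lipschitz:
  assumes "0 \<le> k" "k \<le> s" "0 \<le> l" "l \<le> s"
  shows "\<bar>quad_centre s k - quad_centre s l\<bar> \<le> 2 * s\<^sup>2 * \<bar>k - l\<bar>"
proof -
  let ?p = "k + l" and ?q = "k\<^sup>2 + k * l + l\<^sup>2"
  have "quad_centre s k - quad_centre s l =
      ((s\<^sup>2 - 3 * (s * ?p) + 2 * ?q) / 12 + (2 * (s * ?p) - 3 * ?q) / 20) * (k - l)"
    by (simp add: quad_centre_def field_simps power2_eq_square)
  moreover have "\<bar>(s\<^sup>2 - 3 * (s * ?p) + 2 * ?q) / 12 + (2 * (s * ?p) - 3 * ?q) / 20\<bar> \<le> 2 * s\<^sup>2"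
  proof -
    have gen: "\<bar>(a - 3 * p + 2 * q) / 12 + (2 * p - 3 * q) / 20\<bar> \<le> 2 * a"
      if "0 \<le> p" "p \<le> 2 * a" "0 \<le> q" "q \<le> 3 * a" for a p q :: real
      using that by (simp add: abs_le_iff field_simps)
    have "s * ?p \<le> 2 * s\<^sup>2"
      using mult_left_mono[of ?p "2 * s" s] assms by (simp add: power2_eq_square)
    moreover
    have "k\<^sup>2 \<le> s\<^sup>2" "l\<^sup>2 \<le> s\<^sup>2" "k * l \<le> s\<^sup>2"
      using assms by (auto intro!: power_mono mult_mono simp: power2_eq_square)
    then have "?q \<le> 3 * s\<^sup>2" by linarith
    ultimately show ?thesis using assms by (intro gen) auto
  qed
  ultimately show ?thesis by (simp add: abs_mult mult_right_mono)
qed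

text \<open>The difference is computed exactly and bounded term by term. As \<open>xi\<close> and
  \<open>eta\<close> have root mean squares at most s^(3/2) and s^(5/2), the error is O(s^(5/2)) on
  average, against a centre of order s^3.\<close>

lemma quad_approx:
  assumes S: "S \<in> Om s" and s: "s > 0"
  shows "\<bar>quad s S - quad_centre s (card S)\<bar> \<le> 2 * (real s)\<^sup>2 + \<bar>eta s S\<bar> + 2 * real s * \<bar>xi s S\<bar> + 2 * (xi s S)\<^sup>2 / real s"
proof -
  define k where "k = real (card S)"
  define n where "n = len s S"
  define u where "u = (n - 2 * k) / (2 * n)"
  note B = Om_real_bounds[OF S s, folded k_def n_def]
  have sn: "real s = n + k" by (simp add: n_def k_def len_def)
  have X: "X S = xi s S + k * (n + 1) / 2" by (simp add: xi_def mid_def k_def n_def)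
  have split: "quad s S - quad_centre s k = - (k * (n - k) / (12 * n)) + u * eta s S - xi s S * ((n + 1) * u)
      + (xi s S)\<^sup>2 / n + (k + 2) / 10 * xi s S + k * (3 * n - k + 1) / 20"
    unfolding quad_eq[OF S s, folded k_def n_def] sqdiff_eq[OF S s, folded k_def n_def] X quad_centre_def u_def sn
    using B(5) by (simp add: field_simps power2_eq_square)
  have 1: "\<bar>k * (n - k) / (12 * n)\<bar> \<le> (real s)\<^sup>2"
  proof -
    have "k * (n - k) \<le> real s * n" using B sn by (intro mult_mono) auto
    moreover have "0 \<le> k * (n - k)" using B sn by (intro mult_nonneg_nonneg) auto
    ultimately have "\<bar>k * (n - k)\<bar> / (12 * n) \<le> real s * n / (12 * n)"
      using B by (intro divide_right_mono) auto
    then have "\<bar>k * (n - k) / (12 * n)\<bar> \<le> real s * n / (12 * n)"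
      using B by (simp add: abs_divide)
    also have "\<dots> \<le> real s * real s" using B by (simp add: field_simps)
    finally show ?thesis by (simp add: power2_eq_square)
  qed
  have u: "\<bar>u\<bar> \<le> 1 / 2" using B sn by (simp add: u_def abs_le_iff field_simps)
  have 2: "\<bar>u * eta s S\<bar> \<le> \<bar>eta s S\<bar>"
    unfolding abs_mult using u by (intro mult_left_le_one_le) auto
  have 3: "\<bar>xi s S * ((n + 1) * u)\<bar> \<le> real s * \<bar>xi s S\<bar>"
  proof -
    have "(n + 1) * \<bar>u\<bar> \<le> (2 * real s) * (1 / 2)" using B u by (intro mult_mono) auto
    then have "\<bar>xi s S\<bar> * ((n + 1) * \<bar>u\<bar>) \<le> \<bar>xi s S\<bar> * real s" by (intro mult_left_mono) auto
    then show ?thesis using B by (simp add: abs_mult mult.commute)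
  qed
  have 4: "0 \<le> (xi s S)\<^sup>2 / n" "(xi s S)\<^sup>2 / n \<le> 2 * (xi s S)\<^sup>2 / real s"
  proof -
    show "0 \<le> (xi s S)\<^sup>2 / n" using B by simp
    have "(xi s S)\<^sup>2 / n \<le> (xi s S)\<^sup>2 / (real s / 2)" using B by (intro divide_left_mono) auto
    then show "(xi s S)\<^sup>2 / n \<le> 2 * (xi s S)\<^sup>2 / real s" by (simp add: mult.commute)
  qed
  have 5: "\<bar>(k + 2) / 10 * xi s S\<bar> \<le> real s * \<bar>xi s S\<bar>"
    unfolding abs_mult using B by (intro mult_right_mono) auto
  have 6: "\<bar>k * (3 * n - k + 1) / 20\<bar> \<le> (real s)\<^sup>2"
  proof -
    have "k * (3 * n - k + 1) \<le> real s * (4 * real s)" using B sn by (intro mult_mono) auto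
    moreover have "0 \<le> k * (3 * n - k + 1)" using B sn by (intro mult_nonneg_nonneg) auto
    ultimately show ?thesis by (simp add: power2_eq_square)
  qed
  have "\<bar>- t1 + t2 - t3 + t4 + t5 + t6\<bar> \<le> b1 + b2 + b3 + b4 + b5 + b6"
    if "\<bar>t1\<bar> \<le> b1" "\<bar>t2\<bar> \<le> b2" "\<bar>t3\<bar> \<le> b3" "0 \<le> t4" "t4 \<le> b4" "\<bar>t5\<bar> \<le> b5" "\<bar>t6\<bar> \<le> b6"
    for t1 t2 t3 t4 t5 t6 b1 b2 b3 b4 b5 b6 :: real
    using that unfolding abs_le_iff by linarith
  from this[OF 1 2 3 4 5 6] show ?thesis unfolding split[symmetric] by (simp add: k_def algebra_simps)
qed

lemma av_quad_deviation:
  assumes "s \<ge> 10"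
  shows "av s (\<lambda>S. \<bar>quad s S - quad_centre s (kap s)\<bar>) \<le> 15 * ((real s)\<^sup>2 * sqrt (real s))"
proof -
  have s: "s > 0" "1 \<le> real s" using assms by auto
  let ?r = "sqrt (real s)"
  have "av s (\<lambda>S. \<bar>quad s S - quad_centre s (kap s)\<bar>) \<le>
     av s (\<lambda>S. 2 * (real s)\<^sup>2 + \<bar>eta s S\<bar> + 2 * real s * \<bar>xi s S\<bar> + 2 / real s * (xi s S)\<^sup>2
        + 2 * (real s)\<^sup>2 * \<bar>real (card S) - kap s\<bar>)"
  proof (rule av_mono)
    fix S assume S: "S \<in> Om s"
    have "\<bar>quad_centre s (card S) - quad_centre s (kap s)\<bar> \<le> 2 * (real s)\<^sup>2 * \<bar>real (card S) - kap s\<bar>"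
      using Om_real_bounds[OF S s(1)] kap_bounds[of s] s by (intro quad_centre_lipschitz) auto
    then show "\<bar>quad s S - quad_centre s (kap s)\<bar> \<le> 2 * (real s)\<^sup>2 + \<bar>eta s S\<bar> + 2 * real s * \<bar>xi s S\<bar> + 2 / real s * (xi s S)\<^sup>2
        + 2 * (real s)\<^sup>2 * \<bar>real (card S) - kap s\<bar>"
      using quad_approx[OF S s(1)] by simp
  qed
  also have "\<dots> = 2 * (real s)\<^sup>2 + av s (\<lambda>S. \<bar>eta s S\<bar>) + 2 * real s * av s (\<lambda>S. \<bar>xi s S\<bar>)
      + 2 / real s * av s (\<lambda>S. (xi s S)\<^sup>2) + 2 * (real s)\<^sup>2 * av s (\<lambda>S. \<bar>real (card S) - kap s\<bar>)"
    unfolding av_add av_cmult by simp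
  \<comment> \<open>All terms are brought to the order s^(5/2); the last factor 4 bounds sqrt 12
    from \<open>av_card_variance_le\<close>, and the coefficients add up to 15.\<close>
  also have "\<dots> \<le> 2 * ((real s)\<^sup>2 * ?r) + (real s)\<^sup>2 * ?r + 2 * real s * (real s * ?r)
      + 2 * ((real s)\<^sup>2 * ?r) + 2 * (real s)\<^sup>2 * (4 * ?r)"
  proof (intro add_mono mult_left_mono)
    have r1: "1 \<le> ?r" using s by simp
    show ss: "(real s)\<^sup>2 \<le> (real s)\<^sup>2 * ?r" using mult_left_mono[OF r1, of "(real s)\<^sup>2"] by simp
    show "av s (\<lambda>S. \<bar>eta s S\<bar>) \<le> (real s)\<^sup>2 * ?r" by (intro av_sq_boundD av_eta_sq_le s) auto
    show "av s (\<lambda>S. \<bar>xi s S\<bar>) \<le> real s * ?r" by (intro av_sq_boundD av_xi_sq_le s) auto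
    have "2 / real s * av s (\<lambda>S. (xi s S)\<^sup>2) \<le> 2 / real s * (real s * ?r)\<^sup>2"
      by (intro mult_left_mono av_xi_sq_le s) auto
    also have "\<dots> = 2 * (real s)\<^sup>2" using s by (simp add: power_mult_distrib power2_eq_square)
    finally show "2 / real s * av s (\<lambda>S. (xi s S)\<^sup>2) \<le> 2 * ((real s)\<^sup>2 * ?r)" using ss by linarith
    show "av s (\<lambda>S. \<bar>real (card S) - kap s\<bar>) \<le> 4 * ?r"
      by (rule av_sq_boundD, rule order_trans[OF av_card_variance_le[OF assms]]) (auto simp: power_mult_distrib)
  qed auto
  finally show ?thesis by (simp add: power2_eq_square algebra_simps)
qed

section \<open>The normal approximation\<close>

text \<open>Stein concentration argument: the swap identity is applied to the identity function truncated around \<open>z\<close>.\<close>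

lemma av_X_concentration:
  assumes "s \<ge> 10"
  shows "av s (\<lambda>S. of_bool (\<bar>X S - z\<bar> \<le> real s)) \<le> 82500 / sqrt (real s)"
proof -
  have s: "s > 0" "1 \<le> real s" using assms by auto
  \<comment> \<open>Truncation at 2s leaves room for one exchange, which moves \<open>X\<close> by
    at most s: on the event \<bar>X - z\<bar> \<le> s all increments of \<open>F\<close> are those
    of the identity.\<close>
  define F where "F = (\<lambda>x. max (- 2 * real s) (min (2 * real s) (x - z)))"
  have F_eq: "F x = x - z" if "\<bar>x - z\<bar> \<le> 2 * real s" for x
    using that by (auto simp: F_def max_def min_def)
  have mono: "0 \<le> d * (F (x + d) - F x)" for x d
    by (cases "d \<ge> 0") (auto simp: F_def zero_le_mult_iff)
  let ?P = "\<lambda>S. \<bar>X S - z\<bar> \<le> real s \<and> bulk s S"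
  have "av s (\<lambda>S. real s ^ 3 / 40000 * of_bool (?P S)) \<le> av s (swap_form s F)"
  proof (rule av_mono)
    fix S assume S: "S \<in> Om s"
    note B = Om_real_bounds[OF S s(1)]
    show "real s ^ 3 / 40000 * of_bool (?P S) \<le> swap_form s F S"
    proof (cases "?P S")
      case True
      have "swap_form s F S = swap_form s (\<lambda>x. x) S"
        unfolding swap_form_def
      proof (intro arg_cong2[where f = "(*)"] sum.cong refl)
        fix i j assume "i \<in> S" "j \<in> gaps s S"
        then have "i \<in> {1..s - card S}" "j \<in> {1..s - card S}" using OmD(2)[OF S] by auto
        then have "\<bar>real j - real i\<bar> \<le> real s" using B by auto
        then have "\<bar>X S + (real j - real i) - z\<bar> \<le> 2 * real s" "\<bar>X S - z\<bar> \<le> 2 * real s"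
          using True by (simp_all add: abs_le_iff)
        then show "F (X S + (real j - real i)) - F (X S) = X S + (real j - real i) - X S"
          by (simp add: F_eq)
      qed
      then show ?thesis using swap_form_id_bulk[OF S s(1)] True by simp
    next
      case False
      have "0 \<le> swap_form s F S"
        unfolding swap_form_def using B by (intro mult_nonneg_nonneg sum_nonneg mono) auto
      then show ?thesis using False by auto
    qed
  qed
  also have "\<dots> = av s (\<lambda>S. xi s S * F (X S))"
    unfolding xi_def by (rule av_swap_form[OF s(1)])
  also have "\<dots> \<le> av s (\<lambda>S. (2 * real s) * \<bar>xi s S\<bar>)"
  proof (rule av_mono)
    fix S
    have "\<bar>F (X S)\<bar> \<le> 2 * real s" by (simp add: F_def)
    then have "\<bar>xi s S\<bar> * \<bar>F (X S)\<bar> \<le> \<bar>xi s S\<bar> * (2 * real s)" by (intro mult_left_mono) auto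
    then show "xi s S * F (X S) \<le> 2 * real s * \<bar>xi s S\<bar>"
      using abs_ge_self[of "xi s S * F (X S)"] by (simp add: abs_mult mult.commute)
  qed
  also have "\<dots> \<le> 2 * real s * (real s * sqrt (real s))"
    unfolding av_cmult by (intro mult_left_mono av_sq_boundD av_xi_sq_le s) auto
  finally have "real s ^ 3 * av s (\<lambda>S. of_bool (?P S)) \<le> 80000 * ((real s)\<^sup>2 * sqrt (real s))"
    unfolding av_cmult by (simp add: power2_eq_square)
  also have "\<dots> = real s ^ 3 * (80000 / sqrt (real s))"
    using s by (simp add: power2_eq_square power3_eq_cube field_simps)
  finally have P: "av s (\<lambda>S. of_bool (?P S)) \<le> 80000 / sqrt (real s)"
    using s by (subst (asm) mult_le_cancel_left_pos) auto
  have "av s (\<lambda>S. of_bool (\<bar>X S - z\<bar> \<le> real s)) \<le> av s (\<lambda>S. of_bool (?P S) + of_bool (\<not> bulk s S))"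
    by (rule av_mono) auto
  also have "\<dots> \<le> 80000 / sqrt (real s) + 2500 / real s"
    unfolding av_add by (intro add_mono P av_not_bulk_le assms)
  also have "2500 / real s \<le> 2500 / sqrt (real s)"
  proof (intro divide_left_mono)
    show "sqrt (real s) \<le> real s" using s by (intro real_le_lsqrt) (auto simp: power2_eq_square)
  qed (use s in auto)
  finally show ?thesis by simp
qed

section \<open>Variance and the Berry-Esseen bound\<close>

definition mean_X :: "nat \<Rightarrow> real" where
  "mean_X s = av s X"

definition sd_X :: "nat \<Rightarrow> real" where
  "sd_X s = sqrt (av s (\<lambda>S. (X S - mean_X s)\<^sup>2))"

definition mean_card :: "nat \<Rightarrow> real" where
  "mean_card s = av s (\<lambda>S. real (card S))"

lemma av_sq_nonneg: "0 \<le> av s (\<lambda>S. (F S)\<^sup>2)"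
  unfolding av_def by (simp add: sum_nonneg)

lemma sd_X_nonneg: "0 \<le> sd_X s"
  by (simp add: sd_X_def av_sq_nonneg)

lemma sd_X_sq: "(sd_X s)\<^sup>2 = av s (\<lambda>S. (X S - mean_X s)\<^sup>2)"
  by (simp add: sd_X_def av_sq_nonneg)

lemma av_abs_X_le: "av s (\<lambda>S. \<bar>X S - mean_X s\<bar>) \<le> sd_X s"
  unfolding sd_X_def by (rule av_abs_le_sqrt)

lemma abs_card_deviation_le:
  assumes "S \<in> Om s" "s > 0"
  shows "\<bar>real (card S) - mean_card s\<bar> \<le> real s"
proof -
  have "mean_card s \<le> av s (\<lambda>_. real s)" unfolding mean_card_def
    by (rule av_mono) (use Om_real_bounds[OF _ assms(2)] in force)
  moreover have "av s (\<lambda>_. 0) \<le> mean_card s" unfolding mean_card_def by (rule av_mono) simp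
  ultimately have "0 \<le> mean_card s" "mean_card s \<le> real s" by simp_all
  then show ?thesis using Om_real_bounds(1,2)[OF assms] by linarith
qed

text \<open>The crude bound s on the deviation of k suffices, since the standard deviation of
  \<open>X\<close> is at least of order s^(3/2).\<close>

lemma abs_card_covariance_le:
  assumes "s > 0"
  shows "\<bar>av s (\<lambda>S. (real (card S) - mean_card s) * F S)\<bar> \<le> real s * av s (\<lambda>S. \<bar>F S\<bar>)"
proof -
  have "\<bar>av s (\<lambda>S. (real (card S) - mean_card s) * F S)\<bar> \<le> av s (\<lambda>S. \<bar>(real (card S) - mean_card s) * F S\<bar>)"
    by (rule abs_av_le)
  also have "\<dots> \<le> av s (\<lambda>S. real s * \<bar>F S\<bar>)"
    unfolding abs_mult by (intro av_mono mult_right_mono abs_card_deviation_le assms) auto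
  finally show ?thesis unfolding av_cmult .
qed

text \<open>The Stein identity for x - \<mu>: constants drop out of increments, so its form is
  \<open>quad\<close>, and only the covariance with k separates the variance from the mean of
  \<open>quad\<close>.\<close>

lemma variance_quad:
  assumes "s > 0"
  shows "\<bar>(sd_X s)\<^sup>2 - av s (quad s)\<bar> \<le> 3 / 5 * real s * sd_X s"
proof -
  have "stein_form s (\<lambda>x. x - mean_X s) = quad s"
    by (rule ext) (simp add: quad_def stein_form_def swap_form_def size_form_def)
  then have "(sd_X s)\<^sup>2 - av s (quad s) = 3 / 5 * av s (\<lambda>S. (real (card S) - mean_card s) * (X S - mean_X s))"
    using stein_identity[OF assms, of "\<lambda>x. x - mean_X s"]
    unfolding sd_X_sq by (simp add: power2_eq_square mean_X_def mean_card_def)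
  also have "\<bar>\<dots>\<bar> \<le> 3 / 5 * (real s * av s (\<lambda>S. \<bar>X S - mean_X s\<bar>))"
    using abs_card_covariance_le[OF assms, of "\<lambda>S. X S - mean_X s"] by (simp add: abs_mult)
  also have "\<dots> \<le> 3 / 5 * (real s * sd_X s)"
    by (intro mult_left_mono av_abs_X_le) auto
  finally show ?thesis by simp
qed

text \<open>For s \<ge> 5000 at least half of the mass lies in the bulk, where the exchange part
  alone is at least s^3/40000; elsewhere \<open>quad\<close> is nonnegative.\<close>

lemma av_quad_ge:
  assumes "s \<ge> 5000"
  shows "real s ^ 3 / 80000 \<le> av s (quad s)"
proof -
  have s: "s > 0" "10 \<le> s" "5000 \<le> real s" using assms by auto
  have "av s (\<lambda>S. of_bool (\<not> bulk s S)) \<le> 2500 / real s" by (rule av_not_bulk_le[OF s(2)])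
  also have "\<dots> \<le> 1 / 2" using s by (simp add: field_simps)
  finally have "real s ^ 3 / 40000 * (1 / 2) \<le> real s ^ 3 / 40000 * (1 - av s (\<lambda>S. of_bool (\<not> bulk s S)))"
    by (intro mult_left_mono) auto
  also have "\<dots> = av s (\<lambda>S. real s ^ 3 / 40000 * (1 - of_bool (\<not> bulk s S)))"
    unfolding av_cmult av_diff by simp
  also have "\<dots> \<le> av s (quad s)"
  proof (rule av_mono)
    fix S assume S: "S \<in> Om s"
    have "0 \<le> swap_form s (\<lambda>x. x) S"
      unfolding swap_form_id using sqdiff_nonneg Om_real_bounds(5)[OF S s(1)] by simp
    then show "real s ^ 3 / 40000 * (1 - of_bool (\<not> bulk s S)) \<le> quad s S"
      using swap_form_id_bulk[OF S s(1)] quad_ge_swap_form[OF S s(1)] by (cases "bulk s S") auto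
  qed
  finally show ?thesis by simp
qed

text \<open>In s^3/80000 \<le> \<sigma>^2 + (3/5) s \<sigma> one summand is at least half of the
  left side. If it were only the linear one, \<sigma> would be at least s^2/96000, which for s \<ge>
  100000 makes \<sigma>^2 large as well.\<close>

lemma sd_X_ge:
  assumes "s \<ge> 100000"
  shows "real s * sqrt (real s) / 400 \<le> sd_X s"
proof -
  define r where "r = real s"
  define \<sigma> where "\<sigma> = sd_X s"
  have r: "100000 \<le> r" using assms by (simp add: r_def)
  have \<sigma>0: "0 \<le> \<sigma>" by (simp add: \<sigma>_def sd_X_nonneg)
  have "\<bar>\<sigma>\<^sup>2 - av s (quad s)\<bar> \<le> 3 / 5 * r * \<sigma>" "r ^ 3 / 80000 \<le> av s (quad s)"
    using av_quad_ge[of s] variance_quad[of s] assms unfolding r_def \<sigma>_def by auto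
  then have key: "r ^ 3 / 80000 \<le> \<sigma>\<^sup>2 + 3 / 5 * r * \<sigma>" by linarith
  have "r ^ 3 / 160000 \<le> \<sigma>\<^sup>2"
  proof (rule ccontr)
    assume less: "\<not> r ^ 3 / 160000 \<le> \<sigma>\<^sup>2"
    then have "r ^ 3 / 160000 \<le> 3 / 5 * r * \<sigma>"
      using key by linarith
    then have "r * (r\<^sup>2 / 160000) \<le> r * (3 / 5 * \<sigma>)"
      by (simp add: power3_eq_cube power2_eq_square mult_ac)
    then have "r\<^sup>2 / 160000 \<le> 3 / 5 * \<sigma>" using r by (subst (asm) mult_le_cancel_left_pos) auto
    then have "r\<^sup>2 / 96000 \<le> \<sigma>" by simp
    then have "(r\<^sup>2 / 96000)\<^sup>2 \<le> \<sigma>\<^sup>2" by (intro power_mono) auto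
    moreover have "r ^ 3 * 100000 \<le> r ^ 3 * r" using r by (intro mult_left_mono) auto
    moreover have "(r\<^sup>2 / 96000)\<^sup>2 = r ^ 3 * r / 9216000000"
      by (simp add: power2_eq_square power3_eq_cube)
    moreover have "0 \<le> r ^ 3" using r by simp
    ultimately show False using less by linarith
  qed
  moreover have "(r * sqrt r / 400)\<^sup>2 = r ^ 3 / 160000"
    unfolding power_divide power_mult_distrib using r by (simp add: power2_eq_square power3_eq_cube)
  ultimately have "(r * sqrt r / 400)\<^sup>2 \<le> \<sigma>\<^sup>2" by (simp only:)
  then have "r * sqrt r / 400 \<le> \<sigma>" using \<sigma>0 by (rule power2_le_imp_le)
  then show ?thesis by (simp add: r_def \<sigma>_def)
qed

text \<open>The triangle inequality passes through the mean of \<open>quad\<close> and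
  \<open>quad_centre s (kap s)\<close>. The deviation from the centre is paid twice, so 15 becomes
  30.\<close>

lemma av_abs_quad_variance:
  assumes "s \<ge> 10"
  shows "av s (\<lambda>S. \<bar>(sd_X s)\<^sup>2 - quad s S\<bar>) \<le> 3 / 5 * real s * sd_X s + 30 * ((real s)\<^sup>2 * sqrt (real s))"
proof -
  let ?c = "quad_centre s (kap s)" and ?q = "av s (quad s)"
  let ?d = "av s (\<lambda>S. \<bar>quad s S - ?c\<bar>)"
  have s: "s > 0" using assms by simp
  have "?q - ?c = av s (\<lambda>S. quad s S - ?c)" unfolding av_diff by simp
  then have c: "\<bar>?q - ?c\<bar> \<le> ?d" using abs_av_le by simp
  have "av s (\<lambda>S. \<bar>(sd_X s)\<^sup>2 - quad s S\<bar>) \<le> av s (\<lambda>S. (\<bar>(sd_X s)\<^sup>2 - ?q\<bar> + \<bar>?q - ?c\<bar>) + \<bar>quad s S - ?c\<bar>)"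
    by (rule av_mono) linarith
  also have "\<dots> = \<bar>(sd_X s)\<^sup>2 - ?q\<bar> + \<bar>?q - ?c\<bar> + ?d"
    unfolding av_add by simp
  finally show ?thesis using c variance_quad[OF s] av_quad_deviation[OF assms] by linarith
qed

text \<open>Three errors add up: the fluctuation of \<open>quad\<close> around \<sigma>^2
  (\<open>psi\<close>), the linearisation of the Stein form (\<open>sf\<close>), and the covariance
  with the number of parts (\<open>cov\<close>).\<close>

lemma stein_bound:
  assumes "s \<ge> 100000"
  shows "\<bar>av s (\<lambda>S. of_bool (X S \<le> mean_X s + z * sd_X s)) - Phi z\<bar> \<le> 10 ^ 11 / sqrt (real s)"
proof -
  define r where "r = real s"
  define b where "b = 1 / sqrt r"
  define \<mu> where "\<mu> = mean_X s"
  define \<sigma> where "\<sigma> = sd_X s"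
  define a where "a = r / \<sigma>"
  define W where "W = (\<lambda>S. (X S - \<mu>) / \<sigma>)"
  define F where "F = (\<lambda>x. stein_sol z ((x - \<mu>) / \<sigma>))"
  let ?f = "stein_sol z" and ?\<psi> = "stein_deriv z"
  let ?P = "av s (\<lambda>S. of_bool (X S \<le> \<mu> + z * \<sigma>))"
  have s: "s > 0" "s \<ge> 10" using assms by auto
  have r: "r > 0" using s by (simp add: r_def)
  have b: "b > 0" "b * b * r = 1" using r by (auto simp: b_def)
  have \<sigma>b: "r / (400 * b) \<le> \<sigma>" using sd_X_ge[OF assms] r by (simp add: r_def \<sigma>_def b_def)
  have "0 < r / (400 * b)" using r b by simp
  then have \<sigma>: "\<sigma> > 0" using \<sigma>b by linarith
  have a0: "a > 0" using r \<sigma> by (simp add: a_def)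
  have ab: "a \<le> 400 * b" using \<sigma>b \<sigma> b by (simp add: a_def field_simps)

  \<comment> \<open>Here \<open>a\<close> bounds a step measured in standard deviations. The second
    summand of \<open>e\<close> is the cost of the kink, incurred only when some move may cross it;
    \<open>av_X_concentration\<close> bounds how often that happens.\<close>
  define e where "e = (\<lambda>S. (9 * a\<^sup>2 + 2 * a\<^sup>2 * \<bar>W S\<bar>) + 4 * a * of_bool (\<bar>X S - (\<mu> + z * \<sigma>)\<bar> \<le> r))"
  have approx: "\<bar>stein_form s F S - ?\<psi> (W S) / \<sigma> * quad s S\<bar> \<le> r\<^sup>2 * e S" if S: "S \<in> Om s" for S
    unfolding r_def
  proof (rule stein_form_approx[OF S s(1)])
    fix u assume "\<bar>u\<bar> \<le> real s"
    then have u: "\<bar>u / \<sigma>\<bar> \<le> a" using \<sigma> by (simp add: a_def r_def divide_right_mono)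
    have "F (X S + u) = ?f (W S + u / \<sigma>)" by (simp add: F_def W_def diff_divide_distrib add_divide_distrib algebra_simps)
    moreover have "F (X S) = ?f (W S)" by (simp add: F_def W_def)
    ultimately have "\<bar>F (X S + u) - F (X S) - u * (?\<psi> (W S) / \<sigma>)\<bar> \<le>
        (u / \<sigma>)\<^sup>2 * (9 + 2 * \<bar>W S\<bar>) + (if \<bar>W S - z\<bar> \<le> \<bar>u / \<sigma>\<bar> then 4 * \<bar>u / \<sigma>\<bar> else 0)"
      using stein_sol_taylor[of z "W S" "u / \<sigma>"] by simp
    also have "\<dots> \<le> a\<^sup>2 * (9 + 2 * \<bar>W S\<bar>) + 4 * a * of_bool (\<bar>X S - (\<mu> + z * \<sigma>)\<bar> \<le> r)"
    proof (rule add_mono)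
      have "\<bar>u / \<sigma>\<bar>\<^sup>2 \<le> a\<^sup>2" using u by (intro power_mono) auto
      then have "(u / \<sigma>)\<^sup>2 \<le> a\<^sup>2" by (simp only: power2_abs)
      then show "(u / \<sigma>)\<^sup>2 * (9 + 2 * \<bar>W S\<bar>) \<le> a\<^sup>2 * (9 + 2 * \<bar>W S\<bar>)"
        by (intro mult_right_mono) auto
      have "\<bar>X S - (\<mu> + z * \<sigma>)\<bar> \<le> r" if "\<bar>W S - z\<bar> \<le> \<bar>u / \<sigma>\<bar>"
      proof -
        have "X S - (\<mu> + z * \<sigma>) = \<sigma> * (W S - z)" using \<sigma> by (simp add: W_def field_simps)
        then have "\<bar>X S - (\<mu> + z * \<sigma>)\<bar> = \<sigma> * \<bar>W S - z\<bar>" using \<sigma> by (simp add: abs_mult)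
        also have "\<dots> \<le> \<sigma> * a" using that u \<sigma> by (intro mult_left_mono) auto
        finally show ?thesis using \<sigma> by (simp add: a_def)
      qed
      then show "(if \<bar>W S - z\<bar> \<le> \<bar>u / \<sigma>\<bar> then 4 * \<bar>u / \<sigma>\<bar> else 0) \<le> 4 * a * of_bool (\<bar>X S - (\<mu> + z * \<sigma>)\<bar> \<le> r)"
        using u a0 by auto
    qed
    finally show "\<bar>F (X S + u) - F (X S) - u * (?\<psi> (W S) / \<sigma>)\<bar> \<le> e S" by (simp add: e_def algebra_simps)
  qed
  have avW: "av s (\<lambda>S. \<bar>W S\<bar>) \<le> 1"
  proof -
    have "av s (\<lambda>S. \<bar>W S\<bar>) = 1 / \<sigma> * av s (\<lambda>S. \<bar>X S - \<mu>\<bar>)"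
      unfolding av_cmult[symmetric] W_def using \<sigma> by (simp add: abs_divide)
    also have "\<dots> \<le> 1 / \<sigma> * \<sigma>"
      using \<sigma> av_abs_X_le[of s] by (intro mult_left_mono) (auto simp: \<mu>_def \<sigma>_def)
    finally show ?thesis using \<sigma> by simp
  qed
  have ave: "av s e \<le> 11 * a\<^sup>2 + 4 * a * (82500 * b)"
  proof -
    have "av s e = 9 * a\<^sup>2 + 2 * a\<^sup>2 * av s (\<lambda>S. \<bar>W S\<bar>) + 4 * a * av s (\<lambda>S. of_bool (\<bar>X S - (\<mu> + z * \<sigma>)\<bar> \<le> r))"
      unfolding e_def av_add av_cmult by simp
    also have "\<dots> \<le> 9 * a\<^sup>2 + 2 * a\<^sup>2 * 1 + 4 * a * (82500 * b)"
    proof (intro add_mono mult_left_mono order_refl avW)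
      show "av s (\<lambda>S. of_bool (\<bar>X S - (\<mu> + z * \<sigma>)\<bar> \<le> r)) \<le> 82500 * b"
        using av_X_concentration[OF s(2), of "\<mu> + z * \<sigma>"] by (simp add: r_def b_def)
    qed (use a0 in auto)
    finally show ?thesis by simp
  qed

  have sf: "\<bar>av s (stein_form s F) - av s (\<lambda>S. ?\<psi> (W S) / \<sigma> * quad s S)\<bar> \<le> r\<^sup>2 * av s e"
  proof -
    have "\<bar>av s (\<lambda>S. stein_form s F S - ?\<psi> (W S) / \<sigma> * quad s S)\<bar> \<le>
        av s (\<lambda>S. \<bar>stein_form s F S - ?\<psi> (W S) / \<sigma> * quad s S\<bar>)" by (rule abs_av_le)
    also have "\<dots> \<le> av s (\<lambda>S. r\<^sup>2 * e S)" by (rule av_mono) (rule approx)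
    finally show ?thesis unfolding av_diff av_cmult .
  qed
  have cov: "\<bar>av s (\<lambda>S. (real (card S) - mean_card s) * F (X S))\<bar> \<le> r * 9"
  proof -
    have "av s (\<lambda>S. \<bar>F (X S)\<bar>) \<le> av s (\<lambda>_. 9)" unfolding F_def by (intro av_mono abs_stein_sol_le)
    then have "real s * av s (\<lambda>S. \<bar>F (X S)\<bar>) \<le> r * 9" unfolding r_def by (intro mult_left_mono) auto
    then show ?thesis using abs_card_covariance_le[OF s(1), of "\<lambda>S. F (X S)"] by linarith
  qed
  have psi: "\<bar>av s (\<lambda>S. ?\<psi> (W S) * (\<sigma> - quad s S / \<sigma>))\<bar> \<le> 2 / \<sigma> * (3 / 5 * r * \<sigma> + 30 * (r\<^sup>2 * sqrt r))"
  proof -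
    have "\<bar>av s (\<lambda>S. ?\<psi> (W S) * (\<sigma> - quad s S / \<sigma>))\<bar> \<le> av s (\<lambda>S. \<bar>?\<psi> (W S) * (\<sigma> - quad s S / \<sigma>)\<bar>)"
      by (rule abs_av_le)
    also have "\<dots> \<le> av s (\<lambda>S. 2 / \<sigma> * \<bar>\<sigma>\<^sup>2 - quad s S\<bar>)"
    proof (rule av_mono)
      fix S
      have "\<sigma> - quad s S / \<sigma> = (\<sigma>\<^sup>2 - quad s S) / \<sigma>" using \<sigma> by (simp add: field_simps power2_eq_square)
      then have "\<bar>?\<psi> (W S) * (\<sigma> - quad s S / \<sigma>)\<bar> = \<bar>?\<psi> (W S)\<bar> * (\<bar>\<sigma>\<^sup>2 - quad s S\<bar> / \<sigma>)"
        using \<sigma> by (simp add: abs_mult abs_divide)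
      also have "\<dots> \<le> 2 * (\<bar>\<sigma>\<^sup>2 - quad s S\<bar> / \<sigma>)"
        using \<sigma> by (intro mult_right_mono abs_stein_deriv_le) auto
      finally show "\<bar>?\<psi> (W S) * (\<sigma> - quad s S / \<sigma>)\<bar> \<le> 2 / \<sigma> * \<bar>\<sigma>\<^sup>2 - quad s S\<bar>" by simp
    qed
    also have "\<dots> \<le> 2 / \<sigma> * (3 / 5 * r * \<sigma> + 30 * (r\<^sup>2 * sqrt r))"
      unfolding av_cmult using av_abs_quad_variance[OF s(2)] \<sigma>
      by (intro mult_left_mono) (auto simp: r_def \<sigma>_def)
    finally show ?thesis .
  qed

  have "of_bool (X S \<le> \<mu> + z * \<sigma>) - Phi z = ?\<psi> (W S) - W S * ?f (W S)" for S
  proof -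
    have "X S \<le> \<mu> + z * \<sigma> \<longleftrightarrow> W S \<le> z" using \<sigma> by (auto simp: W_def field_simps)
    then show ?thesis by (simp add: stein_equation)
  qed
  then have "\<sigma> * (?P - Phi z) = \<sigma> * av s (\<lambda>S. ?\<psi> (W S) - W S * ?f (W S))"
    using av_diff[of s "\<lambda>S. of_bool (X S \<le> \<mu> + z * \<sigma>)" "\<lambda>_. Phi z"] by simp
  also have "\<dots> = av s (\<lambda>S. \<sigma> * ?\<psi> (W S)) - av s (\<lambda>S. (X S - \<mu>) * F (X S))"
  proof -
    have "(X S - \<mu>) * F (X S) = \<sigma> * (W S * ?f (W S))" for S using \<sigma> by (simp add: W_def F_def)
    then show ?thesis unfolding av_diff av_cmult by (simp only: av_cmult) (simp add: algebra_simps)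
  qed
  also have "av s (\<lambda>S. (X S - \<mu>) * F (X S)) =
      av s (stein_form s F) + 3 / 5 * av s (\<lambda>S. (real (card S) - mean_card s) * F (X S))"
    unfolding \<mu>_def mean_X_def mean_card_def by (rule stein_identity[OF s(1)])
  also have "av s (\<lambda>S. \<sigma> * ?\<psi> (W S)) =
      av s (\<lambda>S. ?\<psi> (W S) * (\<sigma> - quad s S / \<sigma>)) + av s (\<lambda>S. ?\<psi> (W S) / \<sigma> * quad s S)"
    unfolding av_add[symmetric] by (simp add: algebra_simps)
  finally have "\<bar>\<sigma> * (?P - Phi z)\<bar> \<le> 2 / \<sigma> * (3 / 5 * r * \<sigma> + 30 * (r\<^sup>2 * sqrt r)) + r\<^sup>2 * av s e + 3 / 5 * (r * 9)"
    using psi sf cov by linarith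
  also have "\<dots> \<le> 2 / \<sigma> * (3 / 5 * r * \<sigma> + 30 * (r\<^sup>2 * sqrt r)) + r\<^sup>2 * (11 * a\<^sup>2 + 4 * a * (82500 * b)) + 3 / 5 * (r * 9)"
    using ave by (intro add_mono mult_left_mono order_refl) auto
  finally have "\<bar>?P - Phi z\<bar> \<le> (2 / \<sigma> * (3 / 5 * r * \<sigma> + 30 * (r\<^sup>2 * sqrt r)) + r\<^sup>2 * (11 * a\<^sup>2 + 4 * a * (82500 * b)) + 3 / 5 * (r * 9)) / \<sigma>"
    using \<sigma> by (simp add: abs_mult pos_le_divide_eq mult.commute)
  \<comment> \<open>In terms of a = r/\<sigma> \<le> 400 b and b = 1/sqrt r every summand is O(b);
    the last one, from the kink, dominates the final constant.\<close>
  also have "\<dots> = 33 / 5 * a + 60 * (a\<^sup>2 * sqrt r) + 11 * (a ^ 3 * r) + 330000 * (a\<^sup>2 * r * b)"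
    using \<sigma> by (simp add: a_def field_simps power2_eq_square power3_eq_cube)
  also have "\<dots> \<le> 33 / 5 * (400 * b) + 60 * ((400 * b)\<^sup>2 * sqrt r) + 11 * ((400 * b) ^ 3 * r) + 330000 * ((400 * b)\<^sup>2 * r * b)"
    using ab a0 b r by (intro add_mono mult_left_mono mult_right_mono power_mono) auto
  also have "\<dots> = 2640 * b + 60 * (160000 * b) + 11 * (64000000 * b) + 330000 * (160000 * b)"
  proof -
    have "b * sqrt r = 1" using r by (simp add: b_def)
    then have "b\<^sup>2 * sqrt r = b" by (simp add: power2_eq_square)
    moreover have "b ^ 3 * r = b" "b\<^sup>2 * r = 1" using b by (auto simp: power3_eq_cube power2_eq_square)
    ultimately show ?thesis by (simp add: power_mult_distrib)
  qed
  also have "\<dots> \<le> 10 ^ 11 * b" using b by simp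
  finally show ?thesis by (simp add: \<mu>_def \<sigma>_def b_def r_def)
qed

section \<open>From sets of parts back to partitions\<close>

lemma sorted_gt_nth_le_0:
  assumes "sorted_wrt (>) (la :: nat list)" "i < length la"
  shows "la ! i \<le> la ! 0"
proof (cases i)
  case (Suc m)
  then show ?thesis using sorted_wrt_nth_less[OF assms(1), of 0 i] assms(2) by simp
qed simp

lemma hook_le_perimeter:
  assumes "sorted_wrt (>) la" "(i, j) \<in> cells la"
  shows "hook la i j < la ! 0 + length la"
proof -
  have i: "i < length la" "j < la ! i" using assms(2) by (auto simp: cells_def)
  have "card {r. i < r \<and> r < length la \<and> j < la ! r} \<le> card {Suc i..<length la}"
    by (rule card_mono) auto
  then show ?thesis using i sorted_gt_nth_le_0[OF assms(1) i(1)] unfolding hook_def by simp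
qed

text \<open>Distinctness of the parts makes the hook lengths of the first row decrease in steps of one or two.\<close>

lemma first_row_hook_step:
  assumes "sorted_wrt (>) la" "Suc j < la ! 0"
  shows "hook la 0 j \<le> hook la 0 (Suc j) + 2"
proof -
  let ?A = "{r. 0 < r \<and> r < length la \<and> j < la ! r}" and ?B = "{r. 0 < r \<and> r < length la \<and> Suc j < la ! r}"
  \<comment> \<open>The leg drops by the number of rows of length exactly j + 1, at most one since
    parts are distinct; the arm drops by one.\<close>
  let ?D = "{r. 0 < r \<and> r < length la \<and> la ! r = Suc j}"
  have "p = q" if "p \<in> ?D" "q \<in> ?D" for p q
    using that sorted_wrt_nth_less[OF assms(1), of p q] sorted_wrt_nth_less[OF assms(1), of q p]
    by (cases p q rule: linorder_cases) auto
  then have "card ?D \<le> 1" by (metis (no_types, lifting) card.empty card_le_Suc0_iff_eq card.infinite le0 One_nat_def)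
  moreover have "card ?A \<le> card (?B \<union> ?D)" by (rule card_mono) auto
  moreover have "card (?B \<union> ?D) \<le> card ?B + card ?D" by (rule card_Un_le)
  ultimately have "card ?A \<le> card ?B + 1" by linarith
  then show ?thesis using assms(2) by (simp add: hook_def)
qed

text \<open>Along the first row the hook lengths start at the perimeter, end at 1 and drop by at
  most two per step. If they start at s or more, they cannot jump over both forbidden values s and s
  + 1.\<close>

lemma core_perimeter:
  assumes la: "sorted_wrt (>) la" "\<forall>p\<in>set la. p > 0" "la \<noteq> []" and s: "s > 0"
    and core: "is_core s la" "is_core (s + 1) la"
  shows "la ! 0 + length la \<le> s"
proof (rule ccontr)
  assume "\<not> ?thesis"
  then have big: "s < la ! 0 + length la" by simp
  have pos: "la ! r > 0" if "r < length la" for r using la(2) that by simp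
  have len: "length la > 0" using la(3) by simp
  have row: "hook la 0 j \<noteq> s" "hook la 0 j \<noteq> s + 1" if "j < la ! 0" for j
    using core that len by (auto simp: is_core_def cells_def)
  have large: "s + 1 < hook la 0 j" if "j < la ! 0" for j
    using that
  proof (induction j)
    case 0
    have "{r. 0 < r \<and> r < length la \<and> 0 < la ! r} = {1..<length la}" using pos by auto
    then have "card {r. 0 < r \<and> r < length la \<and> 0 < la ! r} = length la - 1" by simp
    then have "hook la 0 0 + 1 = la ! 0 + length la" using pos[OF len] len unfolding hook_def by linarith
    then show ?case using row[OF 0] big by linarith
  next
    case (Suc j)
    then have "s + 1 < hook la 0 j" by simp
    then show ?case using first_row_hook_step[OF la(1) Suc.prems] row[OF Suc.prems] by linarith
  qed
  have "\<not> la ! 0 - 1 < la ! r" if "0 < r" "r < length la" for r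
    using sorted_wrt_nth_less[OF la(1) that] by linarith
  then have "{r. 0 < r \<and> r < length la \<and> la ! 0 - 1 < la ! r} = {}" by blast
  then have "hook la 0 (la ! 0 - 1) = 1" using pos[OF len] by (simp add: hook_def)
  then show False using large[of "la ! 0 - 1"] pos[OF len] by simp
qed

text \<open>Conversely, a hook length is at most the perimeter
  \<open>la ! 0 + length la - 1\<close>, so a perimeter below s excludes both forbidden values at
  once. The empty partition is exempted because it has no first part.\<close>

lemma dcores_eq:
  assumes "s > 0"
  shows "dcores s = {la. sorted_wrt (>) la \<and> (\<forall>p\<in>set la. p > 0) \<and> (la \<noteq> [] \<longrightarrow> la ! 0 + length la \<le> s)}"
proof (intro set_eqI iffI)
  fix la assume "la \<in> dcores s"
  then show "la \<in> {la. sorted_wrt (>) la \<and> (\<forall>p\<in>set la. p > 0) \<and> (la \<noteq> [] \<longrightarrow> la ! 0 + length la \<le> s)}"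
    using core_perimeter[OF _ _ _ assms] by (auto simp: dcores_def is_partition_def distinct_parts_def)
next
  fix la assume "la \<in> {la. sorted_wrt (>) la \<and> (\<forall>p\<in>set la. p > 0) \<and> (la \<noteq> [] \<longrightarrow> la ! 0 + length la \<le> s)}"
  then have la: "sorted_wrt (>) la" "\<forall>p\<in>set la. p > 0" "la \<noteq> [] \<Longrightarrow> la ! 0 + length la \<le> s" by auto
  have "hook la i j < s" if "(i, j) \<in> cells la" for i j
    using hook_le_perimeter[OF la(1) that] la(3) that by (cases "la = []") (auto simp: cells_def)
  then have "is_core s la" "is_core (s + 1) la" by (force simp: is_core_def)+
  moreover have "sorted_wrt (\<ge>) la" using la(1) by (rule sorted_wrt_mono_rel[rotated]) simp
  ultimately show "la \<in> dcores s" using la by (simp add: dcores_def is_partition_def distinct_parts_def)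
qed

lemma sorted_gt_distinct: "sorted_wrt (>) (la :: nat list) \<Longrightarrow> distinct la"
  by (induction la) auto

text \<open>A strictly decreasing list is determined by its set, and the perimeter condition says
  that the largest element is at most s minus the cardinality.\<close>

lemma bij_betw_dcores_Om:
  assumes "s > 0"
  shows "bij_betw set (dcores s) (Om s)"
proof (rule bij_betw_imageI)
  show "inj_on set (dcores s)"
  proof (rule inj_onI)
    fix la lb assume "la \<in> dcores s" "lb \<in> dcores s" and eq: "set la = set lb"
    then have "sorted_wrt (<) (rev la)" "sorted_wrt (<) (rev lb)"
      by (auto simp: dcores_eq[OF assms] sorted_wrt_rev)
    then have "rev la = rev lb" using eq by (intro strict_sorted_equal) auto
    then show "la = lb" by simp
  qed
  show "set ` dcores s = Om s"
  proof (intro equalityI subsetI)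
    fix S assume "S \<in> set ` dcores s"
    then obtain la where S: "S = set la" and la: "sorted_wrt (>) la" "\<forall>p\<in>set la. p > 0"
      "la \<noteq> [] \<Longrightarrow> la ! 0 + length la \<le> s" by (auto simp: dcores_eq[OF assms])
    have card: "card (set la) = length la" using la(1) by (simp add: distinct_card sorted_gt_distinct)
    have "p \<in> {1..s - length la}" if p: "p \<in> set la" for p
    proof -
      obtain i where i: "i < length la" "p = la ! i" using p by (metis in_set_conv_nth)
      have "p + length la \<le> s" using la(3) p i sorted_gt_nth_le_0[OF la(1) i(1)] by force
      then show ?thesis using la(2) p by (auto simp: Suc_le_eq)
    qed
    then show "S \<in> Om s" unfolding S Om_def using card by auto
  next
    fix S assume S: "S \<in> Om s"
    note D = OmD[OF S]
    define la where "la = rev (sorted_list_of_set S)"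
    have set: "set la = S" and len: "length la = card S" using D(1) by (auto simp: la_def)
    have "sorted_wrt (>) la" by (simp add: la_def sorted_wrt_rev)
    moreover have "\<forall>p\<in>set la. p > 0" using D(2) by (auto simp: set)
    moreover have "la ! 0 + length la \<le> s" if "la \<noteq> []"
    proof -
      have "la ! 0 \<in> S" using that set by (metis length_greater_0_conv nth_mem)
      then have "la ! 0 \<le> s - card S" using D(2) by auto
      then show ?thesis using D(3) len by linarith
    qed
    ultimately show "S \<in> set ` dcores s" using set by (auto simp: dcores_eq[OF assms])
  qed
qed

lemma psize_eq_X:
  assumes "la \<in> dcores s"
  shows "real (psize la) = X (set la)"
proof -
  have "distinct la" using assms by (auto simp: dcores_def distinct_parts_def sorted_gt_distinct)
  then show ?thesis by (simp add: psize_def X_def distinct_sum_list_conv_Sum)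
qed

lemma finite_dcores: "s > 0 \<Longrightarrow> finite (dcores s)"
  using bij_betw_finite[OF bij_betw_dcores_Om] by simp

lemma dcores_nonempty: "s > 0 \<Longrightarrow> dcores s \<noteq> {}"
  by (metis bij_betw_dcores_Om bij_betw_same_card card.empty card_Om_pos less_irrefl)

text \<open>Leaving \<open>h\<close> arbitrary transfers mean, variance and distribution function at
  once.\<close>

lemma expectation_dcores:
  assumes "s > 0"
  shows "measure_pmf.expectation (Xdist s) (\<lambda>la. h (real (psize la))) = av s (\<lambda>S. h (X S))"
proof -
  have "(\<Sum>la\<in>dcores s. h (real (psize la))) = (\<Sum>la\<in>dcores s. h (X (set la)))"
    by (intro sum.cong refl) (simp add: psize_eq_X)
  also have "\<dots> = (\<Sum>S\<in>Om s. h (X S))"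
    by (rule sum.reindex_bij_betw[OF bij_betw_dcores_Om[OF assms]])
  finally show ?thesis
    unfolding Xdist_def av_def
    by (simp add: integral_pmf_of_set finite_dcores dcores_nonempty assms bij_betw_same_card[OF bij_betw_dcores_Om])
qed

lemma core_mean_eq: "s > 0 \<Longrightarrow> core_mean s = mean_X s"
  unfolding core_mean_def mean_X_def by (rule expectation_dcores)

lemma core_sd_eq: "s > 0 \<Longrightarrow> core_sd s = sd_X s"
  unfolding core_sd_def sd_X_def core_mean_eq[symmetric] core_mean_def
  by (simp only: expectation_dcores[where h = "\<lambda>x. (x - c)\<^sup>2" for c])

lemma prob_dcores:
  assumes "s > 0"
  shows "measure_pmf.prob (Xdist s) {la. real (psize la) \<le> c} = av s (\<lambda>S. of_bool (X S \<le> c))"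
proof -
  have "measure_pmf.prob (Xdist s) {la. real (psize la) \<le> c} =
      measure_pmf.expectation (Xdist s) (indicator {la. real (psize la) \<le> c})"
    by simp
  also have "indicator {la. real (psize la) \<le> c} = (\<lambda>la. of_bool (real (psize la) \<le> c) :: real)"
    by (auto simp: indicator_def)
  also have "measure_pmf.expectation (Xdist s) \<dots> = av s (\<lambda>S. of_bool (X S \<le> c))"
    by (rule expectation_dcores[OF assms, of "\<lambda>x. of_bool (x \<le> c)"])
  finally show ?thesis .
qed

theorem theorem1:
  shows "\<exists>C1::real. \<forall>s::nat. s > 0 \<longrightarrow> (\<forall>x::real.
     \<bar>measure_pmf.prob (Xdist s) {la. real (psize la) \<le> core_mean s + x * core_sd s} - Phi x\<bar>
       \<le> C1 / sqrt (real s))"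
proof (intro exI[of _ "10 ^ 11"] allI impI)
  fix s :: nat and x :: real
  assume s: "s > 0"
  show "\<bar>measure_pmf.prob (Xdist s) {la. real (psize la) \<le> core_mean s + x * core_sd s} - Phi x\<bar>
       \<le> 10 ^ 11 / sqrt (real s)"
  \<comment> \<open>For smaller s the claim is trivial: two numbers in [0, 1] differ by at most 1,
    and sqrt s is far below the constant.\<close>
  proof (cases "s \<ge> 100000")
    case True
    then show ?thesis
      using stein_bound[OF True, of x] by (simp add: prob_dcores core_mean_eq core_sd_eq s)
  next
    case False
    let ?p = "measure_pmf.prob (Xdist s) {la. real (psize la) \<le> core_mean s + x * core_sd s}"
    have "0 \<le> ?p" "?p \<le> 1" by auto
    then have "\<bar>?p - Phi x\<bar> \<le> 1" using Phi_nonneg[of x] Phi_le_1[of x] by linarith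
    also have "1 \<le> 10 ^ 11 / sqrt (real s)"
    proof -
      have "real s \<le> (10 ^ 11)\<^sup>2" using False by simp
      then have "sqrt (real s) \<le> 10 ^ 11" by (intro real_le_lsqrt) auto
      then show ?thesis using s by simp
    qed
    finally show ?thesis .
  qed
qed

end
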